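(* For any $\alpha>0$ that is at most a sufficiently small absolute constant and any $\epsilon\in(0,\alpha/3)$, any SQ algorithm that reliably learns $\alpha$-biased halfspaces (for positive labels) on $\mathbb{R}^d$ under Gaussian marginals to additive error $\epsilon$ either (i) requires at least one query of tolerance at most $d^{-\Omega(\log(1/\alpha))}$, or (ii) requires at least $2^{d^{\Omega(1)}}$ queries.
   Context: An $\alpha$-biased halfspace is $h(\mathbf{x})=\mathrm{sign}(\langle\mathbf{w},\mathbf{x}\rangle-t)$ with $\min(\Pr_{\mathbf{x}\sim\mathcal{N}_d}[h=1],\Pr_{\mathbf{x}\sim\mathcal{N}_d}[h=-1])=\alpha$; let $\mathcal{H}_d^\alpha$ be this class. For a distribution $D$ on $\mathbb{R}^d\times\{\pm1\}$ with $\mathbf{x}$-marginal $\mathcal{N}_d$, set $R_+(h;D)=\Pr_D[h(\mathbf{x})=1\wedge y=-1]$, $R_-(h;D)=\Pr_D[h(\mathbf{x})=-1\wedge y=1]$. Reliably learning $\mathcal{H}_d^\alpha$ to error $\epsilon$ means: with probability at least $2/3$, output $h$ with $R_+(h;D)\le\epsilon$ and $R_-(h;D)\le\mathrm{OPT}+\epsilon$, where $\mathrm{OPT}$ is the minimum of $R_-(f;D)$ over $f\in\mathcal{H}_d^\alpha\cup\{f\equiv-1\}$ with $R_+(f;D)=0$. An SQ algorithm accesses $D$ only through queries $q:\mathbb{R}^d\times\{\pm1\}\to[-1,1]$ with tolerance $\tau>0$, receiving any value within $\tau$ of $\mathbb{E}_{(\mathbf{x},y)\sim D}[q(\mathbf{x},y)]$.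 *)

theory Defs
  imports "HOL-Probability.Probability"
begin

text \<open>Points of R^d are functions nat => real; the standard Gaussian on R^d is the product
of d standard normals over the index set {..<d} (its points are extensional outside {..<d}).
Labels are booleans: True stands for +1 and False for -1. Hypotheses are functions
(nat => real) => bool, True meaning the value +1.\<close>

type_synonym point = "nat \<Rightarrow> real"
type_synonym hyp = "point \<Rightarrow> bool"

definition gauss :: "nat \<Rightarrow> point measure" where
  "gauss d = PiM {..<d} (\<lambda>_. density lborel std_normal_density)"

definition inner_d :: "nat \<Rightarrow> point \<Rightarrow> point \<Rightarrow> real" where
  "inner_d d w x = (\<Sum>i<d. w i * x i)"

text \<open>Halfspace sign(<w,x> - t), with the convention sign(0) = +1 (a null event anyway).\<close>
definition halfspace :: "nat \<Rightarrow> point \<Rightarrow> real \<Rightarrow> hyp" where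
  "halfspace d w t = (\<lambda>x. inner_d d w x - t \<ge> 0)"

definition biased_halfspaces :: "real \<Rightarrow> nat \<Rightarrow> hyp set" where
  "biased_halfspaces \<alpha> d = {h. \<exists>w t. h = halfspace d w t \<and>
      min (measure (gauss d) {x \<in> space (gauss d). h x})
          (measure (gauss d) {x \<in> space (gauss d). \<not> h x}) = \<alpha>}"

definition gauss_marginal_dists :: "nat \<Rightarrow> (point \<times> bool) measure set" where
  "gauss_marginal_dists d = {D. prob_space D \<and>
      sets D = sets (gauss d \<Otimes>\<^sub>M count_space UNIV) \<and>
      distr D (gauss d) fst = gauss d}"

definition R_plus :: "hyp \<Rightarrow> (point \<times> bool) measure \<Rightarrow> real" where
  "R_plus h D = measure D {z \<in> space D. h (fst z) \<and> \<not> snd z}"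

definition R_minus :: "hyp \<Rightarrow> (point \<times> bool) measure \<Rightarrow> real" where
  "R_minus h D = measure D {z \<in> space D. \<not> h (fst z) \<and> snd z}"

definition OPT :: "real \<Rightarrow> nat \<Rightarrow> (point \<times> bool) measure \<Rightarrow> real" where
  "OPT \<alpha> d D = Inf {R_minus f D | f. f \<in> biased_halfspaces \<alpha> d \<union> {\<lambda>_. False} \<and> R_plus f D = 0}"

definition reliable_output :: "real \<Rightarrow> nat \<Rightarrow> real \<Rightarrow> (point \<times> bool) measure \<Rightarrow> hyp \<Rightarrow> bool" where
  "reliable_output \<alpha> d \<epsilon> D h \<longleftrightarrow>
     h \<in> measurable (gauss d) (count_space UNIV) \<and>
     R_plus h D \<le> \<epsilon> \<and> R_minus h D \<le> OPT \<alpha> d D + \<epsilon>"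

text \<open>A query is a pair (q, tau) of a query function and a tolerance.\<close>
type_synonym query = "(point \<times> bool \<Rightarrow> real) \<times> real"

definition valid_oracle :: "(point \<times> bool) measure \<Rightarrow> (query \<Rightarrow> real) \<Rightarrow> bool" where
  "valid_oracle D orc \<longleftrightarrow> (\<forall>q \<tau>. q \<in> borel_measurable D \<and> (\<forall>z. \<bar>q z\<bar> \<le> 1) \<and> \<tau> > 0 \<longrightarrow>
       \<bar>orc (q, \<tau>) - (\<integral>z. q z \<partial>D)\<bar> \<le> \<tau>)"

text \<open>A deterministic (adaptive) SQ algorithm maps the list of answers received so far
either to its next query (Inl) or to its output hypothesis (Inr).\<close>
type_synonym sq_alg = "real list \<Rightarrow> query + hyp"

fun sq_hist :: "sq_alg \<Rightarrow> (query \<Rightarrow> real) \<Rightarrow> nat \<Rightarrow> real list" where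
  "sq_hist A orc 0 = []"
| "sq_hist A orc (Suc k) = (let as = sq_hist A orc k in
      (case A as of Inl q \<Rightarrow> as @ [orc q] | Inr h \<Rightarrow> as))"

definition sq_run :: "sq_alg \<Rightarrow> (query \<Rightarrow> real) \<Rightarrow> nat \<Rightarrow> real \<Rightarrow> hyp \<Rightarrow> bool" where
  "sq_run A orc m \<tau>0 h \<longleftrightarrow> (\<exists>k\<le>m. A (sq_hist A orc k) = Inr h \<and>
      (\<forall>j<k. \<exists>q. A (sq_hist A orc j) = Inl q \<and> snd q > \<tau>0))"

text \<open>A randomized SQ algorithm: a probability space R of random seeds and a deterministic
algorithm A r for each seed. It reliably learns H_d^alpha to error epsilon using at most m queries,
each of tolerance > tau0, if for every admissible D and every valid oracle for D, with
(inner) probability at least 2/3 over the seed, the run uses at most m queries of tolerance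
> tau0 and outputs an epsilon-reliable hypothesis.\<close>
definition sq_reliably_learns ::
  "'r measure \<Rightarrow> ('r \<Rightarrow> sq_alg) \<Rightarrow> real \<Rightarrow> nat \<Rightarrow> real \<Rightarrow> nat \<Rightarrow> real \<Rightarrow> bool" where
  "sq_reliably_learns R A \<alpha> d \<epsilon> m \<tau>0 \<longleftrightarrow> prob_space R \<and>
     (\<forall>D \<in> gauss_marginal_dists d. \<forall>orc. valid_oracle D orc \<longrightarrow>
        (\<exists>S \<in> sets R. measure R S \<ge> 2/3 \<and>
           (\<forall>r \<in> S. \<exists>h. sq_run (A r) orc m \<tau>0 h \<and> reliable_output \<alpha> d \<epsilon> D h)))"

end

theory Submission
  imports Defs "HOL-Computational_Algebra.Polynomial" "HOL-Real_Asymp.Real_Asymp"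
begin

text \<open>
  There is \<open>f : \<real> \<rightarrow> [-1, 1]\<close> that equals 1 beyond the quantile \<open>T\<close> of the bias \<open>\<alpha>\<close> and is orthogonal, under the
  standard Gaussian, to all polynomials of degree below \<open>n = \<Omega>(log (1/\<alpha>))\<close>. Give \<open>x\<close> a label with conditional
  mean \<open>f \<langle>v, x\<rangle>\<close> for a hidden unit vector \<open>v\<close>. The halfspace \<open>\<langle>v, x\<rangle> \<ge> T\<close> has no false positives, so a reliable
  hypothesis must correlate with the labels by at least \<open>\<alpha> - 2 \<epsilon>\<close>. Orthogonality makes the functions
  \<open>f \<langle>u, x\<rangle>\<close> and \<open>f \<langle>v, x\<rangle>\<close> have inner product \<open>O(\<bar>\<langle>u, v\<rangle>\<bar>)\<^sup>n\<close>, hence a bounded function of \<open>x\<close> correlates noticeably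
  with only an exponentially small fraction of the normalized sign vectors \<open>v\<close>. An oracle that answers as for
  independent fair labels whenever it can thus forces the learner to make exponentially many queries before
  one of them, or the output itself, depends on \<open>v\<close>.
\<close>

section \<open>Correlated Gaussian pairs\<close>

text \<open>The degree \<open>n\<close> is limited by a trade-off. Moments of the tail beyond
  \<open>T\<close> are cancelled by extrapolating from scales in \<open>[-1/2, 0)\<close> to scale
  1, with coefficients of total size \<open>exp (6 n)\<close>; a copy of the tail shrunk by such a
  scale \<open>l\<close> has, up to a factor \<open>1 / \<bar>l\<bar>\<close>, density at most
  \<open>exp (- 3 T\<^sup>2 / 8)\<close> relative to the Gaussian. So \<open>n\<close> may be a
  small multiple of \<open>T\<^sup>2\<close>, which is of order \<open>ln (1/\<alpha>)\<close>. The
  decay of correlations like an \<open>n\<close>-th power is usually read off a Hermite expansion.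
  Here it comes from truncating the exponential series in the density of a correlated pair. This
  costs a factor 8 in the base, which is harmless because the inner products that matter are at most
  \<open>d powr (- 1/4)\<close>. Sign vectors suit this: two of them are equal or opposite in each
  coordinate, so the two projections of \<open>x\<close> are the sum and the difference of two
  independent Gaussians, and averaging over directions is counting subsets. The final hypothesis is
  handled like one more query, whence the factor \<open>m + 1\<close> in the query bound.\<close>

abbreviation std_gauss :: "real measure" where
  "std_gauss \<equiv> density lborel (\<lambda>x. ennreal (std_normal_density x))"

abbreviation std_gauss2 :: "(real \<times> real) measure" where
  "std_gauss2 \<equiv> std_gauss \<Otimes>\<^sub>M std_gauss"

interpretation std_gauss: prob_space std_gauss
  by (rule prob_space_normal_density) simp

interpretation std_gauss2: pair_prob_space std_gauss std_gauss ..

lemma has_bochner_integral_pair_mult: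
  fixes g h :: "real \<Rightarrow> real"
  assumes "integrable std_gauss g" "integrable std_gauss h"
  shows "has_bochner_integral std_gauss2 (\<lambda>z. g (fst z) * h (snd z))
           (integral\<^sup>L std_gauss g * integral\<^sup>L std_gauss h)"
proof -
  have [measurable]: "g \<in> borel_measurable borel" "h \<in> borel_measurable borel"
    using assms[THEN borel_measurable_integrable] by simp_all
  have i: "integrable std_gauss2 (\<lambda>z. g (fst z) * h (snd z))"
    by (rule std_gauss2.Fubini_integrable)
       (use assms in \<open>auto simp: abs_mult\<close>)
  moreover have "integral\<^sup>L std_gauss2 (\<lambda>z. g (fst z) * h (snd z)) =
      integral\<^sup>L std_gauss g * integral\<^sup>L std_gauss h"
    using std_gauss2.integral_fst'[OF i] by simp
  ultimately show ?thesis by (simp add: has_bochner_integral_iff)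
qed

lemma integrable_power_mult_bounded:
  fixes f :: "real \<Rightarrow> real"
  assumes [measurable]: "f \<in> borel_measurable borel" and "\<And>x. \<bar>f x\<bar> \<le> 1"
  shows "integrable std_gauss (\<lambda>x. x ^ k * f x)"
proof (rule Bochner_Integration.integrable_bound)
  show "integrable std_gauss (\<lambda>x. x ^ k)"
    using integrable_std_normal_moment[of k] by (simp add: integrable_density)
  show "AE x in std_gauss. norm (x ^ k * f x) \<le> norm (x ^ k)"
    using assms(2) by (intro always_eventually) (auto simp: abs_mult mult_left_le)
qed simp

text \<open>The \<open>j\<close>-th power of the quadratic form is homogeneous of degree \<open>2 j\<close>, so each of its monomials,
  multiplied by \<open>x\<^sup>a y\<^sup>b\<close>, has degree less than \<open>n\<close> in one of the two variables.\<close>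
lemma quadratic_form_moment_vanishes:
  fixes f :: "real \<Rightarrow> real"
  assumes [measurable]: "f \<in> borel_measurable borel" and f1: "\<And>x. \<bar>f x\<bar> \<le> 1"
    and mom: "\<And>k. k < n \<Longrightarrow> integral\<^sup>L std_gauss (\<lambda>x. x ^ k * f x) = 0"
  shows "a + b + 2 * j < 2 * n \<Longrightarrow>
    has_bochner_integral std_gauss2 (\<lambda>z. f (fst z) * f (snd z) * fst z ^ a * snd z ^ b *
       (l * fst z * snd z - m * ((fst z)\<^sup>2 + (snd z)\<^sup>2)) ^ j) 0"
proof (induction j arbitrary: a b)
  case 0
  then have "a < n \<or> b < n" by auto
  then have *: "integral\<^sup>L std_gauss (\<lambda>x. x ^ a * f x) * integral\<^sup>L std_gauss (\<lambda>x. x ^ b * f x) = 0"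
    using mom by auto
  show ?case
    using has_bochner_integral_pair_mult[OF integrable_power_mult_bounded[OF assms(1,2), of a]
        integrable_power_mult_bounded[OF assms(1,2), of b]]
    unfolding * by (simp add: mult_ac)
next
  case (Suc j)
  let ?w = "\<lambda>z. l * fst z * snd z - m * ((fst z)\<^sup>2 + (snd z)\<^sup>2)"
  let ?F = "\<lambda>a b z. f (fst z) * f (snd z) * fst z ^ a * snd z ^ b * ?w z ^ j"
  have "has_bochner_integral std_gauss2
      (\<lambda>z. l * ?F (a + 1) (b + 1) z - m * (?F (a + 2) b z + ?F a (b + 2) z)) (l * 0 - m * (0 + 0))"
    using Suc.prems
    by (intro has_bochner_integral_diff has_bochner_integral_add has_bochner_integral_mult_right Suc.IH) auto
  moreover have "(\<lambda>z. l * ?F (a + 1) (b + 1) z - m * (?F (a + 2) b z + ?F a (b + 2) z)) =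
      (\<lambda>z. f (fst z) * f (snd z) * fst z ^ a * snd z ^ b * ?w z ^ Suc j)"
    by (simp add: algebra_simps power2_eq_square)
  ultimately show ?case by simp
qed

text \<open>In the Lagrange remainder \<open>exp t * w ^ n / fact n\<close>, the power is regrouped
  as \<open>(8 r) ^ n * (s / 8) ^ n / fact n\<close>, and the last two factors form one term of the
  series of \<open>exp (s / 8)\<close>. Together with \<open>exp t\<close> this gives growth
  \<open>exp (s / 4)\<close>, which for s = \<open>x\<^sup>2 + y\<^sup>2\<close> is still integrable
  against the Gaussian weight \<open>exp (- s / 2)\<close>.\<close>

lemma exp_remainder_bound:
  fixes w r s :: real
  assumes "\<bar>w\<bar> \<le> r * s" "0 \<le> r" "r \<le> 1/8" "0 \<le> s"
  shows "\<bar>exp w - (\<Sum>j<n. w ^ j / fact j)\<bar> \<le> (8 * r) ^ n * exp (s / 4)"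
proof -
  obtain t where t: "\<bar>t\<bar> \<le> \<bar>w\<bar>" "exp w = (\<Sum>j<n. w ^ j / fact j) + exp t / fact n * w ^ n"
    using Maclaurin_exp_le[of w n] by auto
  have rs: "r * s \<le> s / 8" using mult_right_mono[OF assms(3,4)] by simp
  have "(s / 8) ^ n / fact n \<le> exp (s / 8)"
  proof -
    have "(\<lambda>j. (s / 8) ^ j / fact j) sums exp (s / 8)"
      using exp_converges[of "s / 8"] by (simp add: field_simps)
    from sum_le_suminf[OF sums_summable[OF this], of "{n}"] sums_unique[OF this] assms(4)
    show ?thesis by simp
  qed
  have 1: "(r * s) ^ n / fact n \<le> (8 * r) ^ n * exp (s / 8)"
  proof -
    have "(r * s) ^ n / fact n = (8 * r) ^ n * ((s / 8) ^ n / fact n)"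
      by (simp add: power_mult_distrib power_divide)
    then show ?thesis
      using mult_left_mono[OF \<open>(s / 8) ^ n / fact n \<le> exp (s / 8)\<close>, of "(8 * r) ^ n"] assms(2) by simp
  qed
  have "\<bar>exp w - (\<Sum>j<n. w ^ j / fact j)\<bar> = exp t * (\<bar>w\<bar> ^ n / fact n)"
    using t(2) by (simp add: abs_mult power_abs)
  also have "\<dots> \<le> exp (s / 8) * ((8 * r) ^ n * exp (s / 8))"
  proof (intro mult_mono)
    show "exp t \<le> exp (s / 8)" using t(1) assms(1) rs by simp
    have "\<bar>w\<bar> ^ n / fact n \<le> (r * s) ^ n / fact n"
      using assms(1) by (intro divide_right_mono power_mono) auto
    with 1 show "\<bar>w\<bar> ^ n / fact n \<le> (8 * r) ^ n * exp (s / 8)" by linarith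
  qed auto
  also have "\<dots> = (8 * r) ^ n * (exp (s / 8) * exp (s / 8))"
    by (rule mult.left_commute)
  also have "exp (s / 8) * exp (s / 8) = exp (s / 4)"
    unfolding mult_exp_exp by simp
  finally show ?thesis .
qed

text \<open>The factor halves the Gaussian exponent, which leaves \<open>sqrt 2\<close> times the
  normal density of variance 2.\<close>

lemma has_bochner_integral_exp_square:
  "has_bochner_integral std_gauss (\<lambda>x. exp (x\<^sup>2 / 4)) (sqrt 2)"
proof -
  have "has_bochner_integral lborel (\<lambda>x. sqrt 2 * normal_density 0 (sqrt 2) x) (sqrt 2 * 1)"
    using integral_normal_density[of "sqrt 2" 0] integrable_normal_density[of "sqrt 2" 0]
    by (intro has_bochner_integral_mult_right) (simp add: has_bochner_integral_iff)
  moreover have "sqrt 2 * normal_density 0 (sqrt 2) x = std_normal_density x *\<^sub>R exp (x\<^sup>2 / 4)" for x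
  proof -
    have "exp (- x\<^sup>2 / 2) * exp (x\<^sup>2 / 4) = exp (- x\<^sup>2 / 4)" by (simp add: mult_exp_exp)
    then show ?thesis by (simp add: normal_density_def real_sqrt_mult real_div_sqrt field_simps)
  qed
  ultimately show ?thesis
    by (intro has_bochner_integral_density) auto
qed

text \<open>Up to the factor \<open>1 / sqrt (1 - \<rho>\<^sup>2)\<close>, \<open>exp (w z)\<close> is the density of a \<open>\<rho>\<close>-correlated Gaussian
  pair relative to the standard one. The first \<open>n\<close> terms of its exponential series do not contribute.\<close>
lemma mehler_bound:
  fixes f :: "real \<Rightarrow> real"
  assumes [measurable]: "f \<in> borel_measurable borel" and f1: "\<And>x. \<bar>f x\<bar> \<le> 1"
    and mom: "\<And>k. k < n \<Longrightarrow> integral\<^sup>L std_gauss (\<lambda>x. x ^ k * f x) = 0"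
    and \<rho>: "\<bar>\<rho>\<bar> \<le> 1/8"
  defines "w \<equiv> \<lambda>z. \<rho> / (1 - \<rho>\<^sup>2) * fst z * snd z - \<rho>\<^sup>2 / (2 * (1 - \<rho>\<^sup>2)) * ((fst z)\<^sup>2 + (snd z)\<^sup>2)"
  shows "\<bar>\<integral>z. f (fst z) * f (snd z) * exp (w z) \<partial>std_gauss2\<bar> \<le> 2 * (8 * \<bar>\<rho>\<bar>) ^ n"
proof -
  let ?ff = "\<lambda>z. f (fst z) * f (snd z)"
  let ?S = "\<lambda>z. \<Sum>j<n. w z ^ j / fact j"
  let ?B = "\<lambda>z::real\<times>real. (8 * \<bar>\<rho>\<bar>) ^ n * (exp ((fst z)\<^sup>2 / 4) * exp ((snd z)\<^sup>2 / 4))"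
  have [measurable]: "w \<in> borel_measurable (borel \<Otimes>\<^sub>M borel)"
    unfolding w_def by measurable
  have "has_bochner_integral std_gauss2 (\<lambda>z. \<Sum>j<n. ?ff z * w z ^ j / fact j) (\<Sum>j<n. 0 / fact j)"
  proof (intro has_bochner_integral_sum has_bochner_integral_divide)
    fix j assume "j \<in> {..<n}"
    then show "has_bochner_integral std_gauss2 (\<lambda>z. ?ff z * w z ^ j) 0"
      using quadratic_form_moment_vanishes[OF assms(1,2) mom, of n 0 0 j "\<rho> / (1 - \<rho>\<^sup>2)" "\<rho>\<^sup>2 / (2 * (1 - \<rho>\<^sup>2))"]
      unfolding w_def by simp
  qed
  then have S: "has_bochner_integral std_gauss2 (\<lambda>z. ?ff z * ?S z) 0"
    by (simp add: sum_distrib_left)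
  have B: "has_bochner_integral std_gauss2 ?B ((8 * \<bar>\<rho>\<bar>) ^ n * (sqrt 2 * sqrt 2))"
    using has_bochner_integral_pair_mult[of "\<lambda>x. exp (x\<^sup>2 / 4)" "\<lambda>x. exp (x\<^sup>2 / 4)"]
      has_bochner_integral_exp_square
    by (intro has_bochner_integral_mult_right) (simp add: has_bochner_integral_iff)
  have w: "\<bar>w z\<bar> \<le> \<bar>\<rho>\<bar> * ((fst z)\<^sup>2 + (snd z)\<^sup>2)" for z
  proof -
    let ?s = "(fst z)\<^sup>2 + (snd z)\<^sup>2"
    have r2: "\<rho>\<^sup>2 \<le> \<bar>\<rho>\<bar> / 8"
      using mult_left_mono[OF \<rho>, of "\<bar>\<rho>\<bar>"] by (simp add: power2_eq_square)
    have r3: "\<rho>\<^sup>2 \<le> 1/64"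
      using power_mono[OF \<rho>, of 2] by (simp add: power2_eq_square)
    have xy: "2 * (\<bar>fst z\<bar> * \<bar>snd z\<bar>) \<le> ?s"
      using sum_squares_bound[of "\<bar>fst z\<bar>" "\<bar>snd z\<bar>"] by simp
    define D where "D = 1 - \<rho>\<^sup>2"
    \<comment> \<open>This value makes \<open>2 * D \<ge> 9/8\<close>, which cancels the factor
      \<open>1 + 1/8\<close> that the two terms of the numerator produce.\<close>
    have D: "D \<ge> 9/16" using r3 by (simp add: D_def)
    have "w z = (2 * \<rho> * fst z * snd z - \<rho>\<^sup>2 * ?s) / (2 * D)"
      unfolding w_def D_def[symmetric] diff_divide_distrib by simp
    then have "\<bar>w z\<bar> = \<bar>2 * \<rho> * fst z * snd z - \<rho>\<^sup>2 * ?s\<bar> / (2 * D)"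
      using D by simp
    also have "\<dots> \<le> (\<bar>\<rho>\<bar> * ?s + \<bar>\<rho>\<bar> / 8 * ?s) / (2 * D)"
    proof (rule divide_right_mono)
      have "\<bar>2 * \<rho> * fst z * snd z\<bar> \<le> \<bar>\<rho>\<bar> * ?s"
        using mult_left_mono[OF xy, of "\<bar>\<rho>\<bar>"] by (simp add: abs_mult mult_ac)
      moreover have "\<rho>\<^sup>2 * ?s \<le> \<bar>\<rho>\<bar> / 8 * ?s"
        using r2 by (intro mult_right_mono) auto
      moreover have "0 \<le> \<rho>\<^sup>2 * ?s" by simp
      ultimately show "\<bar>2 * \<rho> * fst z * snd z - \<rho>\<^sup>2 * ?s\<bar> \<le> \<bar>\<rho>\<bar> * ?s + \<bar>\<rho>\<bar> / 8 * ?s"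
        by linarith
    qed (use D in simp)
    also have "\<bar>\<rho>\<bar> * ?s + \<bar>\<rho>\<bar> / 8 * ?s = \<bar>\<rho>\<bar> * ?s * (9/8)" by (simp add: algebra_simps)
    also have "\<bar>\<rho>\<bar> * ?s * (9/8) / (2 * D) \<le> \<bar>\<rho>\<bar> * ?s * (9/8) / (9/8)"
      using D by (intro divide_left_mono) auto
    finally show ?thesis by simp
  qed
  have bound: "\<bar>?ff z * (exp (w z) - ?S z)\<bar> \<le> ?B z" for z
  proof -
    have "\<bar>?ff z\<bar> \<le> 1"
      using mult_mono[OF f1[of "fst z"] f1[of "snd z"]] by (simp add: abs_mult)
    then have "\<bar>?ff z * (exp (w z) - ?S z)\<bar> \<le> \<bar>exp (w z) - ?S z\<bar>"
      using mult_right_mono[of "\<bar>?ff z\<bar>" 1 "\<bar>exp (w z) - ?S z\<bar>"] by (simp add: abs_mult)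
    also have "\<dots> \<le> (8 * \<bar>\<rho>\<bar>) ^ n * exp (((fst z)\<^sup>2 + (snd z)\<^sup>2) / 4)"
      using \<rho> by (intro exp_remainder_bound w) auto
    finally show ?thesis by (simp add: mult_exp_exp add_divide_distrib)
  qed
  have iB: "integrable std_gauss2 ?B" and vB: "integral\<^sup>L std_gauss2 ?B = (8 * \<bar>\<rho>\<bar>) ^ n * 2"
    using B by (auto simp: has_bochner_integral_iff)
  have iR: "integrable std_gauss2 (\<lambda>z. ?ff z * (exp (w z) - ?S z))"
    by (rule Bochner_Integration.integrable_bound[OF iB])
       (use bound in \<open>auto intro!: always_eventually order.trans[OF bound]\<close>)
  have eq: "(\<integral>z. ?ff z * exp (w z) \<partial>std_gauss2) =
        (\<integral>z. ?ff z * (exp (w z) - ?S z) \<partial>std_gauss2)"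
  proof -
    have "(\<integral>z. ?ff z * exp (w z) \<partial>std_gauss2) =
        (\<integral>z. ?ff z * (exp (w z) - ?S z) + ?ff z * ?S z \<partial>std_gauss2)"
      by (rule Bochner_Integration.integral_cong[OF refl]) (simp only: right_diff_distrib diff_add_cancel)
    then show ?thesis
      using Bochner_Integration.integral_add[OF iR] S by (simp only: has_bochner_integral_iff add_0_right)
  qed
  have "\<bar>\<integral>z. ?ff z * (exp (w z) - ?S z) \<partial>std_gauss2\<bar> \<le>
      (\<integral>z. \<bar>?ff z * (exp (w z) - ?S z)\<bar> \<partial>std_gauss2)"
    by (rule integral_abs_bound)
  also have "\<dots> \<le> integral\<^sup>L std_gauss2 ?B"
    by (rule integral_mono[OF integrable_abs[OF iR] iB bound])
  finally show ?thesis unfolding eq vB by simp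
qed

section \<open>A moment-matching function of one variable\<close>

text \<open>Interpolation at \<open>n\<close> nodes reproduces polynomials of degree below
  \<open>n\<close>, and it does so at every \<open>t\<close>. The basis values at \<open>t\<close>
  are thus weights that extrapolate powers from the nodes to \<open>t\<close>.\<close>

lemma lagrange_evaluation:
  fixes l :: "nat \<Rightarrow> real"
  assumes inj: "inj_on l {..<n}" and k: "k < n"
  shows "(\<Sum>i<n. (\<Prod>j\<in>{..<n} - {i}. (t - l j) / (l i - l j)) * l i ^ k) = t ^ k"
proof -
  define Q where "Q i = (\<Prod>j\<in>{..<n} - {i}. smult (1 / (l i - l j)) [:- l j, 1:])" for i
  have Q: "poly (Q i) x = (\<Prod>j\<in>{..<n} - {i}. (x - l j) / (l i - l j))" for i x
    by (simp add: Q_def poly_prod diff_divide_distrib)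
  define P where "P = (\<Sum>i<n. smult (l i ^ k) (Q i))"
  have degQ: "degree (Q i) \<le> n - 1" if "i < n" for i
  proof -
    have "degree (Q i) \<le> (\<Sum>j\<in>{..<n} - {i}. degree (smult (1 / (l i - l j)) [:- l j, 1:]))"
      unfolding Q_def using degree_prod_sum_le by (metis (lifting) finite_Diff finite_lessThan comp_apply sum.cong)
    also have "\<dots> \<le> (\<Sum>j\<in>{..<n} - {i}. 1)"
      by (intro sum_mono) (simp add: degree_smult_le)
    finally show ?thesis using that by simp
  qed
  have deg: "degree P \<le> n - 1"
    unfolding P_def
  proof (rule degree_sum_le)
    show "degree (smult (l i ^ k) (Q i)) \<le> n - 1" if "i \<in> {..<n}" for i
      using that by (intro order.trans[OF degree_smult_le degQ]) simp
  qed simp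
  have "P = monom 1 k"
  proof (rule poly_eqI_degree)
    fix x assume "x \<in> l ` {..<n}"
    then obtain m where m: "m < n" "x = l m" by auto
    have "poly (Q i) x = (if i = m then 1 else 0)" if "i < n" for i
    proof (cases "i = m")
      case True
      have "l m \<noteq> l j" if "j \<in> {..<n} - {m}" for j
        using inj m that by (auto simp: inj_on_def)
      then show ?thesis using True m by (simp add: Q)
    next
      case False
      then show ?thesis using m that by (auto simp: Q intro!: bexI[of _ m])
    qed
    then have "poly P x = (\<Sum>i<n. l i ^ k * (if i = m then 1 else 0))"
      by (simp add: P_def poly_sum)
    also have "\<dots> = x ^ k" using m by (simp add: if_distrib cong: if_cong)
    finally show "poly P x = poly (monom 1 k) x" by (simp add: poly_monom)
  qed (use deg k card_image[OF inj] in \<open>auto simp: degree_monom_eq\<close>)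
  then have "poly P t = t ^ k" by (simp add: poly_monom)
  then show ?thesis by (simp add: P_def poly_sum Q mult.commute)
qed

lemma prod_abs_diff_nat:
  assumes "i < n"
  shows "(\<Prod>j\<in>{..<n} - {i}. \<bar>real i - real j\<bar>) = fact i * fact (n - 1 - i)"
proof -
  have split: "{..<n} - {i} = {..<i} \<union> {i<..<n}" using assms by auto
  have "(\<Prod>j\<in>{..<n} - {i}. \<bar>real i - real j\<bar>) =
     (\<Prod>j<i. \<bar>real i - real j\<bar>) * (\<Prod>j\<in>{i<..<n}. \<bar>real i - real j\<bar>)"
    unfolding split by (rule prod.union_disjoint) auto
  also have "(\<Prod>j<i. \<bar>real i - real j\<bar>) = (\<Prod>j\<in>{1..i}. real j)"
    by (rule prod.reindex_bij_witness[of _ "\<lambda>j. i - j" "\<lambda>j. i - j"]) auto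
  also have "(\<Prod>j\<in>{i<..<n}. \<bar>real i - real j\<bar>) = (\<Prod>j\<in>{1..n - 1 - i}. real j)"
    by (rule prod.reindex_bij_witness[of _ "\<lambda>j. j + i" "\<lambda>j. j - i"]) auto
  finally show ?thesis by (simp add: fact_prod)
qed

text \<open>The coefficients are the Lagrange weights for the point 1. Each numerator is at most
  \<open>3/2\<close> and the nodes are \<open>1 / (2 n)\<close> apart, so a factor is at most
  \<open>3 n / \<bar>i - j\<bar>\<close>. The denominators multiply to
  \<open>fact i * fact (n - 1 - i)\<close>, which makes the sum over \<open>i\<close> a row of
  binomial coefficients; the resulting \<open>(6 n) ^ (n - 1) / fact (n - 1)\<close> is one term of
  the series of \<open>exp (6 n)\<close>.\<close>

lemma extrapolation_coefficients:
  assumes n: "0 < n"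
  obtains c :: "nat \<Rightarrow> real" where
    "\<And>k. k < n \<Longrightarrow> (\<Sum>i<n. c i * (- (real i + 1) / (2 * real n)) ^ k) = 1"
    "(\<Sum>i<n. \<bar>c i\<bar>) \<le> exp (6 * real n)"
proof
  let ?l = "\<lambda>i. - (real i + 1) / (2 * real n)"
  let ?c = "\<lambda>i. \<Prod>j\<in>{..<n} - {i}. (1 - ?l j) / (?l i - ?l j)"
  show "(\<Sum>i<n. ?c i * ?l i ^ k) = 1" if "k < n" for k
    using lagrange_evaluation[of ?l n k 1] that n by (auto simp: inj_on_def field_simps)
  have "\<bar>?c i\<bar> \<le> (3 * real n) ^ (n - 1) / fact (n - 1) * real (n - 1 choose i)" if i: "i < n" for i
  proof -
    have "\<bar>?c i\<bar> = (\<Prod>j\<in>{..<n} - {i}. \<bar>1 - ?l j\<bar> / \<bar>?l i - ?l j\<bar>)"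
      by (simp add: abs_prod)
    also have "\<dots> \<le> (\<Prod>j\<in>{..<n} - {i}. 3 * real n / \<bar>real i - real j\<bar>)"
    proof (rule prod_mono)
      fix j assume j: "j \<in> {..<n} - {i}"
      have e: "\<bar>?l i - ?l j\<bar> = \<bar>real i - real j\<bar> / (2 * real n)"
      proof -
        have "?l i - ?l j = (real j - real i) / (2 * real n)" using n by (simp add: field_simps)
        then show ?thesis by (simp add: abs_minus_commute)
      qed
      have "\<bar>1 - ?l j\<bar> \<le> 3 / 2" using j n by (auto simp: field_simps)
      then have "\<bar>1 - ?l j\<bar> / \<bar>?l i - ?l j\<bar> \<le> (3 / 2) / \<bar>?l i - ?l j\<bar>"
        by (intro divide_right_mono) auto
      also have "\<dots> = 3 * real n / \<bar>real i - real j\<bar>" unfolding e using n by simp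
      finally show "0 \<le> \<bar>1 - ?l j\<bar> / \<bar>?l i - ?l j\<bar> \<and>
        \<bar>1 - ?l j\<bar> / \<bar>?l i - ?l j\<bar> \<le> 3 * real n / \<bar>real i - real j\<bar>" by simp
    qed
    also have "\<dots> = (3 * real n) ^ (n - 1) / (fact i * fact (n - 1 - i))"
      using i by (simp add: prod_dividef prod_abs_diff_nat)
    also have "\<dots> = (3 * real n) ^ (n - 1) / fact (n - 1) * real (n - 1 choose i)"
      using i by (simp add: binomial_fact)
    finally show ?thesis .
  qed
  then have "(\<Sum>i<n. \<bar>?c i\<bar>) \<le> (\<Sum>i<n. (3 * real n) ^ (n - 1) / fact (n - 1) * real (n - 1 choose i))"
    by (intro sum_mono) auto
  also have "\<dots> = (3 * real n) ^ (n - 1) / fact (n - 1) * real (\<Sum>i\<le>n - 1. n - 1 choose i)"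
  proof -
    have "{..<n} = {..n - 1}" using n by auto
    then show ?thesis by (simp add: sum_distrib_left)
  qed
  also have "\<dots> = (6 * real n) ^ (n - 1) / fact (n - 1)"
  proof -
    have "real (\<Sum>i\<le>n - 1. n - 1 choose i) = 2 ^ (n - 1)"
      unfolding choose_row_sum by simp
    moreover have "(6 * real n) ^ (n - 1) = (3 * real n) ^ (n - 1) * 2 ^ (n - 1)"
      using power_mult_distrib[of "3 * real n" 2 "n - 1"] by simp
    ultimately show ?thesis by (simp only: times_divide_eq_left)
  qed
  also have "\<dots> \<le> exp (6 * real n)"
  proof -
    have "(\<lambda>j. (6 * real n) ^ j / fact j) sums exp (6 * real n)"
      using exp_converges[of "6 * real n"] by (simp add: field_simps)
    from sum_le_suminf[OF sums_summable[OF this], of "{n - 1}"] sums_unique[OF this]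
    show ?thesis by simp
  qed
  finally show "(\<Sum>i<n. \<bar>?c i\<bar>) \<le> exp (6 * real n)" .
qed

text \<open>The integrand contains the density, relative to the standard Gaussian, of the image of
  the Gaussian tail on \<open>{T..}\<close> under multiplication by \<open>l\<close>. Substituting
  \<open>y = l * x\<close> therefore scales the \<open>k\<close>-th moment by \<open>l ^ k\<close>;
  since \<open>l\<close> is negative, the half-line is reversed.\<close>

lemma gaussian_tail_dilation:
  fixes l T :: real
  assumes l: "l < 0"
  shows "integral\<^sup>L std_gauss
      (\<lambda>y. y ^ k * (exp (- y\<^sup>2 / 2 * (1 / l\<^sup>2 - 1)) / \<bar>l\<bar> * indicator {..l * T} y)) =
    l ^ k * integral\<^sup>L std_gauss (\<lambda>x. x ^ k * indicator {T..} x)"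
proof -
  let ?g = "\<lambda>y. std_normal_density y *
      (y ^ k * (exp (- y\<^sup>2 / 2 * (1 / l\<^sup>2 - 1)) / \<bar>l\<bar> * indicator {..l * T} y))"
  have "integral\<^sup>L lborel ?g = \<bar>l\<bar> * (\<integral>x. ?g (0 + l * x) \<partial>lborel)"
    using lborel_integral_real_affine[of l ?g 0] l by simp
  also have "\<dots> = (\<integral>x. \<bar>l\<bar> * ?g (0 + l * x) \<partial>lborel)" by simp
  also have "\<dots> = (\<integral>x. l ^ k * (std_normal_density x * (x ^ k * indicator {T..} x)) \<partial>lborel)"
  proof (rule Bochner_Integration.integral_cong[OF refl])
    fix x :: real
    have "- (l * x)\<^sup>2 / 2 + (- (l * x)\<^sup>2 / 2 * (1 / l\<^sup>2 - 1)) = - x\<^sup>2 / 2"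
      using l by (simp add: field_simps)
    then have "exp (- (l * x)\<^sup>2 / 2) * exp (- (l * x)\<^sup>2 / 2 * (1 / l\<^sup>2 - 1)) = exp (- x\<^sup>2 / 2)"
      by (simp only: mult_exp_exp)
    then have "std_normal_density (l * x) * exp (- (l * x)\<^sup>2 / 2 * (1 / l\<^sup>2 - 1)) = std_normal_density x"
      by (simp add: std_normal_density_def)
    moreover have "indicator {..l * T} (l * x) = (indicator {T..} x :: real)"
      using l by (simp add: indicator_def)
    moreover have "\<bar>l\<bar> * ?g (0 + l * x) = (std_normal_density (l * x) * exp (- (l * x)\<^sup>2 / 2 * (1 / l\<^sup>2 - 1))) *
        ((l * x) ^ k * indicator {..l * T} (l * x))"
      using l by simp
    ultimately show "\<bar>l\<bar> * ?g (0 + l * x) = l ^ k * (std_normal_density x * (x ^ k * indicator {T..} x))"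
      by (simp add: power_mult_distrib)
  qed
  finally show ?thesis
    by (simp add: integral_density)
qed

text \<open>Only the negative axis threatens the bound \<open>\<bar>f x\<bar> \<le> 1\<close>,
  because all subtracted copies live there. Their sum costs \<open>exp (6 n)\<close> for the
  coefficients and \<open>1 / \<bar>l i\<bar> \<le> 2 n \<le> exp (2 n)\<close> for the dilations,
  and gains \<open>exp (- 3 T\<^sup>2 / 8)\<close>; \<open>nT\<close> says that the gain
  wins.\<close>

lemma moment_matching_function:
  fixes T :: real
  assumes n: "0 < n" and T: "0 < T" and nT: "8 * real n \<le> 3 * T\<^sup>2 / 8"
  obtains f :: "real \<Rightarrow> real" where
    "f \<in> borel_measurable borel" "\<And>x. \<bar>f x\<bar> \<le> 1" "\<And>x. x \<ge> T \<Longrightarrow> f x = 1"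
    "\<And>k. k < n \<Longrightarrow> integral\<^sup>L std_gauss (\<lambda>x. x ^ k * f x) = 0"
proof -
  define l where "l i = - (real i + 1) / (2 * real n)" for i
  obtain c where c: "\<And>k. k < n \<Longrightarrow> (\<Sum>i<n. c i * l i ^ k) = 1" "(\<Sum>i<n. \<bar>c i\<bar>) \<le> exp (6 * real n)"
    using extrapolation_coefficients[OF n] unfolding l_def by blast
  have l0: "l i < 0" for i using n by (simp add: l_def field_simps)
  have l1: "l i \<ge> - (1/2)" if "i < n" for i using that n by (simp add: l_def field_simps)
  have l2: "\<bar>l i\<bar> * (2 * real n) \<ge> 1" for i using n by (simp add: l_def)
  have lsq: "(l i)\<^sup>2 \<le> 1/4" if "i < n" for i
    using power_mono[of "- l i" "1/2" 2] l1[OF that] l0[of i] by (simp add: power2_eq_square)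
  define e where "e i y = exp (- y\<^sup>2 / 2 * (1 / (l i)\<^sup>2 - 1)) * indicator {..l i * T} y" for i and y :: real
  define g where "g i y = exp (- y\<^sup>2 / 2 * (1 / (l i)\<^sup>2 - 1)) / \<bar>l i\<bar> * indicator {..l i * T} y" for i and y :: real
  \<comment> \<open>\<open>f\<close> subtracts from the tail beyond \<open>T\<close> its images under the dilations by \<open>l i\<close>. These have the same
    moments of order below \<open>n\<close> by extrapolation, live on the negative axis since \<open>l i < 0\<close>, and are tiny
    relative to the Gaussian density since \<open>\<bar>l i\<bar> \<le> 1/2\<close>.\<close>
  define f where "f y = indicator {T..} y - (\<Sum>i<n. c i * g i y)" for y :: real
  have ge: "g i y = e i y / \<bar>l i\<bar>" for i y by (simp add: g_def e_def)
  have [measurable]: "e i \<in> borel_measurable borel" for i unfolding e_def[abs_def] by measurable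
  have e_nonneg: "0 \<le> e i y" for i y by (simp add: e_def)
  \<comment> \<open>On the support \<open>\<bar>y\<bar> \<ge> \<bar>l i\<bar> * T\<close>, so the
    exponent is at most \<open>- T\<^sup>2 * (1 - (l i)\<^sup>2) / 2\<close>, and
    \<open>(l i)\<^sup>2 \<le> 1/4\<close>.\<close>
  have e_le: "e i y \<le> exp (- (3 * T\<^sup>2 / 8))" if "i < n" for i y
  proof (cases "y \<le> l i * T")
    case True
    have neg: "l i * T < 0" using T l0[of i] by (simp add: mult_neg_pos)
    have "(l i * T)\<^sup>2 \<le> y\<^sup>2" using power_mono[of "- (l i * T)" "- y" 2] True neg by simp
    moreover have p: "1 / (l i)\<^sup>2 - 1 \<ge> 0" using lsq[OF that] l0[of i] by (simp add: field_simps)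
    ultimately have "(l i * T)\<^sup>2 * (1 / (l i)\<^sup>2 - 1) \<le> y\<^sup>2 * (1 / (l i)\<^sup>2 - 1)"
      by (intro mult_right_mono)
    moreover have "(l i * T)\<^sup>2 * (1 / (l i)\<^sup>2 - 1) = T\<^sup>2 * (1 - (l i)\<^sup>2)"
      using l0[of i] by (simp add: field_simps)
    moreover have "T\<^sup>2 * (1 - (l i)\<^sup>2) \<ge> T\<^sup>2 * (3/4)"
      using lsq[OF that] by (intro mult_left_mono) auto
    ultimately have "T\<^sup>2 * (3/4) \<le> y\<^sup>2 * (1 / (l i)\<^sup>2 - 1)" by (simp only:)
    moreover have "- Q / 2 \<le> - (3 * T\<^sup>2 / 8)" if "T\<^sup>2 * (3/4) \<le> Q" for Q :: real
      using that by simp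
    ultimately have "- y\<^sup>2 / 2 * (1 / (l i)\<^sup>2 - 1) \<le> - (3 * T\<^sup>2 / 8)"
      by (simp only: mult_minus_left divide_minus_left times_divide_eq_left)
    then show ?thesis using True by (simp add: e_def)
  qed (simp add: e_def)
  have gi: "integrable std_gauss (\<lambda>y. y ^ k * g i y)" if "i < n" for i k
  proof -
    have "\<bar>e i y\<bar> \<le> 1" for y
    proof -
      have "exp (- (3 * T\<^sup>2 / 8)) \<le> 1" by simp
      then show ?thesis using e_le[OF that, of y] e_nonneg[of i y] by linarith
    qed
    then show ?thesis
      using integrable_divide[OF integrable_power_mult_bounded[of "e i" k], of "\<bar>l i\<bar>"]
      by (simp add: ge)
  qed
  have "f y = 1" if "y \<ge> T" for y
  proof -
    have "g i y = 0" for i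
      using that T mult_neg_pos[OF l0[of i] T] by (simp add: g_def)
    then show ?thesis using that by (simp add: f_def)
  qed
  moreover have "\<bar>f y\<bar> \<le> 1" for y
  proof (cases "y \<ge> 0")
    case True
    then have "g i y = 0" for i
      using T mult_neg_pos[OF l0[of i] T] by (simp add: g_def)
    then show ?thesis by (simp add: f_def indicator_def)
  next
    case False
    have "\<bar>f y\<bar> = \<bar>\<Sum>i<n. c i * g i y\<bar>" using False T by (simp add: f_def)
    also have "\<dots> \<le> (\<Sum>i<n. \<bar>c i * g i y\<bar>)" by (rule sum_abs)
    also have "\<dots> \<le> (\<Sum>i<n. \<bar>c i\<bar> * (exp (- (3 * T\<^sup>2 / 8)) * exp (2 * real n)))"
    proof (rule sum_mono)
      fix i assume "i \<in> {..<n}"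
      then have i: "i < n" by simp
      have "1 / \<bar>l i\<bar> \<le> 2 * real n" using l2[of i] l0[of i] by (simp add: field_simps)
      also have "\<dots> \<le> exp (2 * real n)" using exp_ge_add_one_self[of "2 * real n"] by linarith
      finally have "e i y * (1 / \<bar>l i\<bar>) \<le> exp (- (3 * T\<^sup>2 / 8)) * exp (2 * real n)"
        using e_le[OF i, of y] e_nonneg[of i y] by (intro mult_mono) auto
      then show "\<bar>c i * g i y\<bar> \<le> \<bar>c i\<bar> * (exp (- (3 * T\<^sup>2 / 8)) * exp (2 * real n))"
        using mult_left_mono[of "e i y * (1 / \<bar>l i\<bar>)" _ "\<bar>c i\<bar>"] e_nonneg[of i y]
        by (simp add: ge abs_mult)
    qed
    also have "\<dots> = (\<Sum>i<n. \<bar>c i\<bar>) * (exp (- (3 * T\<^sup>2 / 8)) * exp (2 * real n))"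
      by (simp add: sum_distrib_right)
    also have "\<dots> \<le> exp (6 * real n) * (exp (- (3 * T\<^sup>2 / 8)) * exp (2 * real n))"
      using c(2) by (intro mult_right_mono) auto
    also have "\<dots> = exp (8 * real n - 3 * T\<^sup>2 / 8)"
      unfolding mult_exp_exp by simp
    also have "\<dots> \<le> 1" using nT by simp
    finally show ?thesis .
  qed
  moreover have "integral\<^sup>L std_gauss (\<lambda>x. x ^ k * f x) = 0" if k: "k < n" for k
  proof -
    let ?m = "integral\<^sup>L std_gauss (\<lambda>x. x ^ k * indicator {T..} x)"
    have i1: "integrable std_gauss (\<lambda>x. x ^ k * indicator {T..} x)"
      by (rule integrable_power_mult_bounded) (auto simp: indicator_def)
    have i2: "integrable std_gauss (\<lambda>x. \<Sum>i<n. c i * (x ^ k * g i x))"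
      using gi by (intro Bochner_Integration.integrable_sum) auto
    have "integral\<^sup>L std_gauss (\<lambda>x. x ^ k * f x) =
        integral\<^sup>L std_gauss (\<lambda>x. x ^ k * indicator {T..} x - (\<Sum>i<n. c i * (x ^ k * g i x)))"
      by (simp add: f_def right_diff_distrib sum_distrib_left mult_ac)
    also have "\<dots> = ?m - integral\<^sup>L std_gauss (\<lambda>x. \<Sum>i<n. c i * (x ^ k * g i x))"
      using i1 i2 by (rule Bochner_Integration.integral_diff)
    also have "integral\<^sup>L std_gauss (\<lambda>x. \<Sum>i<n. c i * (x ^ k * g i x)) =
        (\<Sum>i<n. c i * integral\<^sup>L std_gauss (\<lambda>x. x ^ k * g i x))"
      using gi by (subst Bochner_Integration.integral_sum) auto
    also have "\<dots> = (\<Sum>i<n. c i * l i ^ k * ?m)"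
      unfolding g_def gaussian_tail_dilation[OF l0] by (simp add: mult.assoc)
    also have "\<dots> = ?m" using c(1)[OF k] by (simp add: sum_distrib_right[symmetric])
    finally show ?thesis by simp
  qed
  moreover have "f \<in> borel_measurable borel"
    unfolding f_def[abs_def] ge by measurable
  ultimately show ?thesis using that by blast
qed

section \<open>Tails and quantiles of the standard Gaussian\<close>

lemma measure_std_gauss: "A \<in> sets borel \<Longrightarrow> measure std_gauss A = (\<integral>x. std_normal_density x * indicator A x \<partial>lborel)"
  using integral_density[of "indicator A :: real \<Rightarrow> real" lborel std_normal_density] by simp

text \<open>The interval from \<open>a\<close> to \<open>2 * a\<close> has length at least 1, and
  the density on it is at least its value at \<open>2 * a\<close>; \<open>exp 2\<close> absorbs
  \<open>sqrt (2 * pi)\<close>. The lossy exponent is enough to show that \<open>a\<^sup>2\<close>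
  is at least of the order of the logarithm of the inverse tail.\<close>

lemma std_gauss_tail_ge:
  assumes "1 \<le> a"
  shows "measure std_gauss {a..} \<ge> exp (- 2 * a\<^sup>2 - 2)"
proof -
  have s3: "sqrt (2 * pi) \<le> exp 2"
  proof -
    have "sqrt (2 * pi) \<le> sqrt 9" using pi_less_4 by (intro real_sqrt_le_mono) auto
    also have "sqrt 9 = (3::real)" by (simp add: real_sqrt_unique)
    finally show ?thesis using exp_ge_add_one_self[of "2::real"] by linarith
  qed
  have "exp (- 2 * a\<^sup>2 - 2) = exp (- 2 * a\<^sup>2) / exp 2" by (simp add: exp_diff)
  also have "\<dots> \<le> exp (- 2 * a\<^sup>2) / sqrt (2 * pi)"
    using s3 by (intro divide_left_mono) auto
  also have "\<dots> = std_normal_density (2 * a)" by (simp add: std_normal_density_def power2_eq_square)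
  also have "\<dots> \<le> a * std_normal_density (2 * a)"
    using mult_right_mono[OF assms, of "std_normal_density (2 * a)"] by simp
  also have "\<dots> = (\<integral>x. std_normal_density (2 * a) * indicator {a..2 * a} x \<partial>lborel)"
    using assms by simp
  also have "\<dots> \<le> (\<integral>x. std_normal_density x * indicator {a..2 * a} x \<partial>lborel)"
  proof (rule integral_mono)
    show "integrable lborel (\<lambda>x. std_normal_density x * indicator {a..2 * a} x)"
      by (intro integrable_real_mult_indicator) auto
    show "std_normal_density (2 * a) * indicator {a..2 * a} x \<le> std_normal_density x * indicator {a..2 * a} x" for x
    proof (cases "x \<in> {a..2 * a}")
      case True
      then have "x\<^sup>2 \<le> (2 * a)\<^sup>2" using assms by (intro power_mono) auto
      then show ?thesis using True by (simp add: std_normal_density_def divide_right_mono)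
    qed simp
  qed (intro integrable_mult_right integrable_real_indicator, use assms in auto)
  also have "\<dots> = measure std_gauss {a..2 * a}" by (simp add: measure_std_gauss)
  also have "\<dots> \<le> measure std_gauss {a..}" by (intro std_gauss.finite_measure_mono) auto
  finally show ?thesis .
qed

lemma std_gauss_quantile:
  assumes "0 < \<alpha>" "\<alpha> < 1"
  obtains T where "measure std_gauss {T..} = \<alpha>"
proof -
  interpret real_distribution std_gauss
    by (simp add: real_distribution_def real_distribution_axioms_def std_gauss.prob_space_axioms)
  have null: "measure std_gauss {x} = 0" for x
  proof -
    have "AE y in lborel. std_normal_density y * indicator {x} y = 0"
      using AE_lborel_singleton[of x] by eventually_elim simp
    then have "(\<integral>y. std_normal_density y * indicator {x} y \<partial>lborel) = 0"
      by (rule integral_eq_zero_AE)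
    then show ?thesis by (simp add: measure_std_gauss)
  qed
  then have cont: "isCont (cdf std_gauss) x" for x by (simp add: isCont_cdf)
  have "eventually (\<lambda>x. cdf std_gauss x < 1 - \<alpha>) at_bot"
    using assms by (intro order_tendstoD(2)[OF cdf_lim_at_bot]) auto
  then obtain a where a: "cdf std_gauss a < 1 - \<alpha>" by (auto simp: eventually_at_bot_linorder)
  have "eventually (\<lambda>x. cdf std_gauss x > 1 - \<alpha>) at_top"
    using assms by (intro order_tendstoD(1)[OF cdf_lim_at_top_prob]) auto
  then obtain b where b: "cdf std_gauss b > 1 - \<alpha>" by (auto simp: eventually_at_top_linorder)
  have "a \<le> b"
  proof (rule ccontr)
    assume "\<not> a \<le> b"
    then show False using cdf_nondecreasing[of b a] a b by simp
  qed
  then obtain T where T: "cdf std_gauss T = 1 - \<alpha>"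
    using IVT[of "cdf std_gauss" a "1 - \<alpha>" b] a b cont by auto
  have "measure std_gauss (- {..<T}) = 1 - measure std_gauss {..<T}"
    using std_gauss.prob_compl[of "{..<T}"] by (simp add: Compl_eq_Diff_UNIV)
  moreover have "measure std_gauss {..T} = measure std_gauss {..<T} + measure std_gauss {T}"
    using std_gauss.finite_measure_Union[of "{..<T}" "{T}"] by (simp add: ivl_disj_un flip: ivl_disj_un_singleton)
  moreover have "- {..<T} = {T..}" by auto
  ultimately have "measure std_gauss {T..} = \<alpha>" using T null by (simp add: cdf_def)
  then show ?thesis by (rule that)
qed

lemma hidden_direction_profile:
  fixes \<alpha> :: real
  assumes "0 < \<alpha>" "\<alpha> \<le> exp (- 100)"
  obtains T n and f :: "real \<Rightarrow> real" where
    "real n \<ge> ln (1 / \<alpha>) / 200" "measure std_gauss {T..} = \<alpha>"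
    "f \<in> borel_measurable borel" "\<And>x. \<bar>f x\<bar> \<le> 1" "\<And>x. x \<ge> T \<Longrightarrow> f x = 1"
    "\<And>k. k < n \<Longrightarrow> integral\<^sup>L std_gauss (\<lambda>x. x ^ k * f x) = 0"
proof -
  let ?L = "ln (1 / \<alpha>)"
  have "ln \<alpha> \<le> ln (exp (- 100))" using assms by (subst ln_le_cancel_iff) auto
  then have L: "?L \<ge> 100" using assms by (simp add: ln_div)
  have "\<alpha> < 1" using assms(2) by (smt (verit) exp_less_one_iff)
  then obtain T where T: "measure std_gauss {T..} = \<alpha>"
    using std_gauss_quantile assms(1) by blast
  have "T \<ge> 1"
  proof (rule ccontr)
    assume "\<not> T \<ge> 1"
    then have "measure std_gauss {1..} \<le> measure std_gauss {T..}"
      by (intro std_gauss.finite_measure_mono) auto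
    moreover have "exp (- 4) \<le> measure std_gauss {1..}" using std_gauss_tail_ge[of 1] by simp
    moreover have "exp (- 100) < exp (- 4 :: real)" by simp
    ultimately show False using T assms(2) by linarith
  qed
  have "?L \<le> 2 * T\<^sup>2 + 2"
  proof -
    have "exp (- 2 * T\<^sup>2 - 2) \<le> \<alpha>" using std_gauss_tail_ge[OF \<open>T \<ge> 1\<close>] T by simp
    then have "- 2 * T\<^sup>2 - 2 \<le> ln \<alpha>" using assms(1) by (simp add: ln_ge_iff)
    then show ?thesis using assms(1) by (simp add: ln_div)
  qed
  then have TL: "T\<^sup>2 \<ge> ?L / 4" using L by simp
  \<comment> \<open>Since \<open>T\<^sup>2 \<ge> ?L / 4\<close>, the condition
    \<open>8 n \<le> 3 T\<^sup>2 / 8\<close> holds up to \<open>n = 3 * ?L / 256\<close>, and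
    \<open>?L / 100\<close> lies below this. As \<open>?L \<ge> 100\<close>, the floor is at least 1
    and loses at most a factor 2.\<close>
  define n where "n = nat \<lfloor>?L / 100\<rfloor>"
  have n: "real n \<le> ?L / 100" "real n > ?L / 100 - 1" "n \<ge> 1"
    using L unfolding n_def by linarith+
  have "8 * real n \<le> 3 * T\<^sup>2 / 8" using n TL L by simp
  from moment_matching_function[OF _ _ this] n \<open>T \<ge> 1\<close> obtain f :: "real \<Rightarrow> real" where
    "f \<in> borel_measurable borel" "\<And>x. \<bar>f x\<bar> \<le> 1" "\<And>x. x \<ge> T \<Longrightarrow> f x = 1"
    "\<And>k. k < n \<Longrightarrow> integral\<^sup>L std_gauss (\<lambda>x. x ^ k * f x) = 0"
    by auto
  moreover have "real n \<ge> ?L / 200" using n L by linarith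
  ultimately show ?thesis using n T by (intro that[of n T f]) auto
qed

section \<open>Hidden directions in the Gaussian space\<close>

text \<open>For independent centred normals P and Q with deviations \<sigma> and \<tau>, the
  variables P + Q and P - Q have variance 1 and covariance \<rho>. The left side is their joint
  density by change of variables, with Jacobian \<open>1/2\<close>; the right side is the bivariate
  normal density relative to the product. Both rest on
  \<open>1 - \<rho>\<^sup>2 = 4 * \<sigma>\<^sup>2 * \<tau>\<^sup>2\<close>.\<close>

lemma rotated_normal_density:
  fixes \<sigma> \<tau> x y :: real
  assumes "0 < \<sigma>" "0 < \<tau>" and one: "\<sigma>\<^sup>2 + \<tau>\<^sup>2 = 1"
  defines "\<rho> \<equiv> \<sigma>\<^sup>2 - \<tau>\<^sup>2"
  shows "normal_density 0 \<sigma> ((x + y) / 2) * normal_density 0 \<tau> ((x - y) / 2) / 2 =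
    std_normal_density x * std_normal_density y *
      (exp (\<rho> / (1 - \<rho>\<^sup>2) * x * y - \<rho>\<^sup>2 / (2 * (1 - \<rho>\<^sup>2)) * (x\<^sup>2 + y\<^sup>2)) / sqrt (1 - \<rho>\<^sup>2))"
proof -
  define s t where "s = \<sigma>\<^sup>2" and "t = \<tau>\<^sup>2"
  have st: "0 < s" "0 < t" "t = 1 - s" using assms by (simp_all add: s_def t_def)
  have \<rho>: "\<rho> = 2 * s - 1" using st by (simp add: \<rho>_def s_def t_def)
  have D: "1 - \<rho>\<^sup>2 = 4 * s * t" unfolding \<rho> st(3) by (simp add: power2_eq_square algebra_simps)
  have sq: "sqrt (1 - \<rho>\<^sup>2) = 2 * \<sigma> * \<tau>"
    unfolding D using assms(1,2) by (simp add: s_def t_def real_sqrt_mult)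
  have ex: "- ((x + y) / 2)\<^sup>2 / (2 * s) + - ((x - y) / 2)\<^sup>2 / (2 * t) =
      (- x\<^sup>2 / 2 + - y\<^sup>2 / 2) + (\<rho> / (4 * s * t) * x * y - \<rho>\<^sup>2 / (2 * (4 * s * t)) * (x\<^sup>2 + y\<^sup>2))"
  proof -
    have "(- ((x + y) / 2)\<^sup>2 / (2 * s) + - ((x - y) / 2)\<^sup>2 / (2 * t)) * (8 * s * t) =
       - (x + y)\<^sup>2 * t - (x - y)\<^sup>2 * s"
      using st(1,2) by (simp add: field_simps power2_eq_square)
    also have "\<dots> = - (x\<^sup>2 + y\<^sup>2) * (4 * s * t + \<rho>\<^sup>2) + 2 * \<rho> * x * y"
      unfolding \<rho> st(3) by (simp add: power2_eq_square algebra_simps)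
    also have "\<dots> = ((- x\<^sup>2 / 2 + - y\<^sup>2 / 2) + (\<rho> / (4 * s * t) * x * y - \<rho>\<^sup>2 / (2 * (4 * s * t)) * (x\<^sup>2 + y\<^sup>2))) * (8 * s * t)"
      using st(1,2) by (simp add: field_simps)
    finally show ?thesis using st(1,2) by simp
  qed
  have "normal_density 0 \<sigma> ((x + y) / 2) * normal_density 0 \<tau> ((x - y) / 2) / 2 =
      (exp (- ((x + y) / 2)\<^sup>2 / (2 * s)) * exp (- ((x - y) / 2)\<^sup>2 / (2 * t))) / (4 * pi * \<sigma> * \<tau>)"
    using assms(1,2) by (simp add: normal_density_def s_def t_def real_sqrt_mult)
  also have "exp (- ((x + y) / 2)\<^sup>2 / (2 * s)) * exp (- ((x - y) / 2)\<^sup>2 / (2 * t)) =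
      (exp (- x\<^sup>2 / 2) * exp (- y\<^sup>2 / 2)) *
      exp (\<rho> / (4 * s * t) * x * y - \<rho>\<^sup>2 / (2 * (4 * s * t)) * (x\<^sup>2 + y\<^sup>2))"
    unfolding mult_exp_exp ex ..
  also have "\<dots> / (4 * pi * \<sigma> * \<tau>) = std_normal_density x * std_normal_density y *
      (exp (\<rho> / (4 * s * t) * x * y - \<rho>\<^sup>2 / (2 * (4 * s * t)) * (x\<^sup>2 + y\<^sup>2)) / (2 * \<sigma> * \<tau>))"
    by (simp add: std_normal_density_def real_sqrt_mult)
  finally show ?thesis unfolding D[symmetric] sq[symmetric] .
qed

text \<open>The linear change of variables is done one coordinate at a time, with Tonelli exchanging
  the order in between; nonnegative \<open>g\<close> avoids all integrability conditions.\<close>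

lemma nn_integral_sum_diff_normal:
  fixes \<sigma> \<tau> :: real and g :: "real \<times> real \<Rightarrow> ennreal"
  assumes [arith]: "0 < \<sigma>" "0 < \<tau>" and one: "\<sigma>\<^sup>2 + \<tau>\<^sup>2 = 1"
    and [measurable]: "g \<in> borel_measurable (borel \<Otimes>\<^sub>M borel)"
  defines "\<rho> \<equiv> \<sigma>\<^sup>2 - \<tau>\<^sup>2"
  shows "(\<integral>\<^sup>+z. g (fst z + snd z, fst z - snd z)
      \<partial>(density lborel (normal_density 0 \<sigma>) \<Otimes>\<^sub>M density lborel (normal_density 0 \<tau>))) =
    (\<integral>\<^sup>+z. ennreal (exp (\<rho> / (1 - \<rho>\<^sup>2) * fst z * snd z - \<rho>\<^sup>2 / (2 * (1 - \<rho>\<^sup>2)) * ((fst z)\<^sup>2 + (snd z)\<^sup>2)) /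
      sqrt (1 - \<rho>\<^sup>2)) * g z \<partial>std_gauss2)"
proof -
  let ?p = "\<lambda>p. ennreal (normal_density 0 \<sigma> p)" and ?q = "\<lambda>q. ennreal (normal_density 0 \<tau> q)"
  let ?M = "\<lambda>x y. exp (\<rho> / (1 - \<rho>\<^sup>2) * x * y - \<rho>\<^sup>2 / (2 * (1 - \<rho>\<^sup>2)) * (x\<^sup>2 + y\<^sup>2)) / sqrt (1 - \<rho>\<^sup>2)"
  interpret T: prob_space "density lborel ?q" by (rule prob_space_normal_density) simp
  have \<rho>1: "1 - \<rho>\<^sup>2 \<ge> 0"
  proof -
    have "1 - \<rho>\<^sup>2 = (\<sigma>\<^sup>2 + \<tau>\<^sup>2)\<^sup>2 - (\<sigma>\<^sup>2 - \<tau>\<^sup>2)\<^sup>2" using one by (simp add: \<rho>_def)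
    also have "\<dots> = 4 * (\<sigma>\<^sup>2 * \<tau>\<^sup>2)" by (simp add: power2_eq_square algebra_simps)
    finally show ?thesis by simp
  qed
  have "(\<integral>\<^sup>+z. g (fst z + snd z, fst z - snd z) \<partial>(density lborel ?p \<Otimes>\<^sub>M density lborel ?q)) =
      (\<integral>\<^sup>+p. \<integral>\<^sup>+q. g (p + q, p - q) \<partial>density lborel ?q \<partial>density lborel ?p)"
    by (subst T.nn_integral_fst[symmetric]) simp_all
  also have "\<dots> = (\<integral>\<^sup>+p. \<integral>\<^sup>+q. ?p p * (?q q * g (p + q, p - q)) \<partial>lborel \<partial>lborel)"
    by (simp add: nn_integral_density nn_integral_cmult)
  also have "\<dots> = (\<integral>\<^sup>+q. \<integral>\<^sup>+p. ?p p * (?q q * g (p + q, p - q)) \<partial>lborel \<partial>lborel)"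
    by (rule lborel_pair.Fubini'[symmetric]) simp
  also have "\<dots> = (\<integral>\<^sup>+q. \<integral>\<^sup>+x. ?p (x - q) * (?q q * g (x, x - 2 * q)) \<partial>lborel \<partial>lborel)"
  proof (rule nn_integral_cong)
    fix q :: real
    show "(\<integral>\<^sup>+p. ?p p * (?q q * g (p + q, p - q)) \<partial>lborel) =
        (\<integral>\<^sup>+x. ?p (x - q) * (?q q * g (x, x - 2 * q)) \<partial>lborel)"
      by (subst nn_integral_real_affine[of _ 1 "- q"]) (simp_all add: algebra_simps)
  qed
  also have "\<dots> = (\<integral>\<^sup>+x. \<integral>\<^sup>+q. ?p (x - q) * (?q q * g (x, x - 2 * q)) \<partial>lborel \<partial>lborel)"
    by (rule lborel_pair.Fubini') simp
  also have "\<dots> = (\<integral>\<^sup>+x. \<integral>\<^sup>+y. ennreal (std_normal_density x) * (ennreal (std_normal_density y) *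
      (ennreal (?M x y) * g (x, y))) \<partial>lborel \<partial>lborel)"
  proof (rule nn_integral_cong)
    fix x :: real
    have "(\<integral>\<^sup>+q. ?p (x - q) * (?q q * g (x, x - 2 * q)) \<partial>lborel) =
        ennreal (1/2) * (\<integral>\<^sup>+y. ?p ((x + y) / 2) * (?q ((x - y) / 2) * g (x, y)) \<partial>lborel)"
      \<comment> \<open>The substitution is \<open>q = (x - y) / 2\<close>, so
        \<open>x - q = (x + y) / 2\<close> and \<open>x - 2 * q = y\<close>.\<close>
      by (subst nn_integral_real_affine[of _ "- 1/2" "x / 2"]) (simp_all add: field_simps)
    also have "\<dots> = (\<integral>\<^sup>+y. ennreal (1/2) * (?p ((x + y) / 2) * (?q ((x - y) / 2) * g (x, y))) \<partial>lborel)"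
      by (rule nn_integral_cmult[symmetric]) simp
    also have "\<dots> = (\<integral>\<^sup>+y. ennreal (std_normal_density x) * (ennreal (std_normal_density y) *
      (ennreal (?M x y) * g (x, y))) \<partial>lborel)"
    proof (rule nn_integral_cong)
      fix y :: real
      have "ennreal (1/2) * (?p ((x + y) / 2) * (?q ((x - y) / 2) * g (x, y))) =
          ennreal (normal_density 0 \<sigma> ((x + y) / 2) * normal_density 0 \<tau> ((x - y) / 2) / 2) * g (x, y)"
      proof -
        have "ennreal (1 / 2 * (a * b)) = ennreal (1/2) * (ennreal a * ennreal b)" if "0 \<le> a" "0 \<le> b" for a b
          using that by (simp only: ennreal_mult mult_nonneg_nonneg zero_le_divide_1_iff zero_le_numeral)
        from this[of "normal_density 0 \<sigma> ((x + y) / 2)" "normal_density 0 \<tau> ((x - y) / 2)"]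
        show ?thesis by (simp add: mult.assoc)
      qed
      also have "\<dots> = ennreal (std_normal_density x * std_normal_density y * ?M x y) * g (x, y)"
        using rotated_normal_density[of \<sigma> \<tau> x y] one by (simp add: \<rho>_def)
      also have "\<dots> = ennreal (std_normal_density x) * (ennreal (std_normal_density y) *
          (ennreal (?M x y) * g (x, y)))"
      proof -
        have "ennreal (a * b * c) = ennreal a * (ennreal b * ennreal c)" if "0 \<le> a" "0 \<le> b" "0 \<le> c" for a b c
          using that by (simp add: ennreal_mult mult.assoc)
        moreover have "0 \<le> ?M x y" using \<rho>1 by simp
        ultimately show ?thesis by (simp only: normal_density_nonneg mult.assoc)
      qed
      finally show "ennreal (1/2) * (?p ((x + y) / 2) * (?q ((x - y) / 2) * g (x, y))) =
          ennreal (std_normal_density x) * (ennreal (std_normal_density y) *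
          (ennreal (?M x y) * g (x, y)))" .
    qed
    finally show "(\<integral>\<^sup>+q. ?p (x - q) * (?q q * g (x, x - 2 * q)) \<partial>lborel) =
      (\<integral>\<^sup>+y. ennreal (std_normal_density x) * (ennreal (std_normal_density y) *
      (ennreal (?M x y) * g (x, y))) \<partial>lborel)" .
  qed
  also have "\<dots> = (\<integral>\<^sup>+x. \<integral>\<^sup>+y. ennreal (?M x y) * g (x, y) \<partial>std_gauss \<partial>std_gauss)"
    by (simp add: nn_integral_density nn_integral_cmult)
  also have "\<dots> = (\<integral>\<^sup>+z. ennreal (?M (fst z) (snd z)) * g z \<partial>std_gauss2)"
    by (subst std_gauss.nn_integral_fst[symmetric]) simp_all
  finally show ?thesis .
qed

text \<open>The nonnegative case, applied to indicators, identifies the law of the pair of sum and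
  difference; signed \<open>g\<close> can then be integrated against that law.\<close>

lemma integral_sum_diff_normal:
  fixes \<sigma> \<tau> :: real and g :: "real \<times> real \<Rightarrow> real"
  assumes [arith]: "0 < \<sigma>" "0 < \<tau>" and one: "\<sigma>\<^sup>2 + \<tau>\<^sup>2 = 1"
    and [measurable]: "g \<in> borel_measurable (borel \<Otimes>\<^sub>M borel)"
  defines "\<rho> \<equiv> \<sigma>\<^sup>2 - \<tau>\<^sup>2"
  shows "(\<integral>z. g (fst z + snd z, fst z - snd z)
      \<partial>(density lborel (normal_density 0 \<sigma>) \<Otimes>\<^sub>M density lborel (normal_density 0 \<tau>))) =
    (\<integral>z. exp (\<rho> / (1 - \<rho>\<^sup>2) * fst z * snd z - \<rho>\<^sup>2 / (2 * (1 - \<rho>\<^sup>2)) * ((fst z)\<^sup>2 + (snd z)\<^sup>2)) /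
      sqrt (1 - \<rho>\<^sup>2) * g z \<partial>std_gauss2)"
    (is "integral\<^sup>L ?N _ = (\<integral>z. ?M z * g z \<partial>_)")
proof -
  have "(\<sigma>\<^sup>2 + \<tau>\<^sup>2)\<^sup>2 - (\<sigma>\<^sup>2 - \<tau>\<^sup>2)\<^sup>2 = 4 * (\<sigma>\<^sup>2 * \<tau>\<^sup>2)" by (simp add: power2_eq_square algebra_simps)
  then have \<rho>1: "1 - \<rho>\<^sup>2 \<ge> 0" using one by (simp add: \<rho>_def)
  have eq: "distr ?N (borel \<Otimes>\<^sub>M borel) (\<lambda>z. (fst z + snd z, fst z - snd z)) =
      density std_gauss2 (\<lambda>z. ennreal (?M z))"
  proof (rule measure_eqI)
    fix X assume "X \<in> sets (distr ?N (borel \<Otimes>\<^sub>M borel) (\<lambda>z. (fst z + snd z, fst z - snd z)))"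
    then have [measurable]: "X \<in> sets (borel \<Otimes>\<^sub>M borel)" by simp
    have "emeasure (distr ?N (borel \<Otimes>\<^sub>M borel) (\<lambda>z. (fst z + snd z, fst z - snd z))) X =
        (\<integral>\<^sup>+z. indicator X z \<partial>distr ?N (borel \<Otimes>\<^sub>M borel) (\<lambda>z. (fst z + snd z, fst z - snd z)))"
      by simp
    also have "\<dots> = (\<integral>\<^sup>+z. indicator X (fst z + snd z, fst z - snd z) \<partial>?N)"
      by (rule nn_integral_distr) simp_all
    also have "\<dots> = (\<integral>\<^sup>+z. ennreal (?M z) * indicator X z \<partial>std_gauss2)"
      unfolding \<rho>_def using assms(1-3) by (rule nn_integral_sum_diff_normal) simp
    also have "\<dots> = emeasure (density std_gauss2 (\<lambda>z. ennreal (?M z))) X"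
      by (rule emeasure_density[symmetric]) simp_all
    finally show "emeasure (distr ?N (borel \<Otimes>\<^sub>M borel) (\<lambda>z. (fst z + snd z, fst z - snd z))) X =
        emeasure (density std_gauss2 (\<lambda>z. ennreal (?M z))) X" .
  qed simp
  have "(\<integral>z. g (fst z + snd z, fst z - snd z) \<partial>?N) =
      integral\<^sup>L (distr ?N (borel \<Otimes>\<^sub>M borel) (\<lambda>z. (fst z + snd z, fst z - snd z))) g"
    by (rule integral_distr[symmetric]) simp_all
  also have "\<dots> = (\<integral>z. ?M z * g z \<partial>std_gauss2)"
    unfolding eq using \<rho>1 by (subst integral_density) simp_all
  finally show ?thesis .
qed

section \<open>Linear forms on the Gaussian product space\<close>

lemma prob_space_gauss: "prob_space (gauss d)"
  unfolding gauss_def by (intro prob_space_PiM std_gauss.prob_space_axioms)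

interpretation gauss: prob_space "gauss d" for d
  by (rule prob_space_gauss)

lemma measurable_gauss_component [measurable]: "i < d \<Longrightarrow> (\<lambda>x. x i) \<in> borel_measurable (gauss d)"
  unfolding gauss_def by (rule measurable_compose[OF measurable_component_singleton]) auto

lemma measurable_inner_d [measurable]: "inner_d d w \<in> borel_measurable (gauss d)"
  unfolding inner_d_def[abs_def] by measurable

lemma gauss_component_distributed:
  assumes "i < d"
  shows "distributed (gauss d) lborel (\<lambda>x. x i) (normal_density 0 1)"
proof -
  have "distr (gauss d) std_gauss (\<lambda>x. x i) = std_gauss"
    unfolding gauss_def
    by (rule distr_PiM_component) (use assms std_gauss.prob_space_axioms in auto)
  moreover have "distr (gauss d) std_gauss (\<lambda>x. x i) = distr (gauss d) lborel (\<lambda>x. x i)"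
    by (rule distr_cong) auto
  ultimately show ?thesis using assms by (simp add: distributed_def)
qed

lemma gauss_components_indep:
  assumes "0 < d"
  shows "gauss.indep_vars d (\<lambda>_. borel) (\<lambda>i x. x i) {..<d}"
proof -
  have c: "distr (gauss d) borel (\<lambda>x. x i) = std_gauss" if "i < d" for i
  proof -
    have "distr (gauss d) borel (\<lambda>x. x i) = distr (gauss d) lborel (\<lambda>x. x i)"
      by (rule distr_cong) auto
    then show ?thesis using gauss_component_distributed[OF that] by (simp add: distributed_def)
  qed
  have "distr (gauss d) (PiM {..<d} (\<lambda>_. borel)) (\<lambda>x. restrict x {..<d}) = distr (gauss d) (gauss d) (\<lambda>x. x)"
    by (rule distr_cong) (auto simp: gauss_def space_PiM restrict_PiE_iff intro!: sets_PiM_cong)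
  also have "\<dots> = PiM {..<d} (\<lambda>i. distr (gauss d) borel (\<lambda>x. x i))"
    using c by (subst distr_id2) (auto simp: gauss_def intro!: PiM_cong)
  finally show ?thesis
    using assms by (subst gauss.indep_vars_iff_distr_eq_PiM') auto
qed

lemma gauss_linear_form_distributed:
  assumes "0 < d" "J \<subseteq> {..<d}" "J \<noteq> {}" and c: "\<And>i. i \<in> J \<Longrightarrow> c i \<noteq> 0"
  shows "distributed (gauss d) lborel (\<lambda>x. \<Sum>i\<in>J. c i * x i) (normal_density 0 (sqrt (\<Sum>i\<in>J. (c i)\<^sup>2)))"
proof -
  have fin: "finite J" using assms(2) finite_subset by blast
  have "gauss.indep_vars d (\<lambda>_. borel) (\<lambda>i x. c i * x i) J"
    by (rule gauss.indep_vars_compose2[where Y = "\<lambda>i y. c i * y",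
          OF gauss.indep_vars_subset[OF gauss_components_indep[OF assms(1)] assms(2)]]) simp
  then have "distributed (gauss d) lborel (\<lambda>x. \<Sum>i\<in>J. c i * x i)
      (normal_density (\<Sum>i\<in>J. 0) (sqrt (\<Sum>i\<in>J. \<bar>c i\<bar>\<^sup>2)))"
  proof (rule gauss.sum_indep_normal[OF fin assms(3)])
    show "0 < \<bar>c i\<bar>" if "i \<in> J" for i using c that by simp
    show "distributed (gauss d) lborel (\<lambda>x. c i * x i) (\<lambda>x. ennreal (normal_density 0 \<bar>c i\<bar> x))" if "i \<in> J" for i
      using gauss.normal_density_affine[OF gauss_component_distributed[of i d], of "c i" 0] that assms(2) c[OF that]
      by auto
  qed
  then show ?thesis by simp
qed

lemma gauss_linear_forms_indep:
  assumes "0 < d" "J \<union> K \<subseteq> {..<d}" "J \<inter> K = {}"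
  shows "gauss.indep_var d borel (\<lambda>x. \<Sum>i\<in>J. c i * x i) borel (\<lambda>x. \<Sum>i\<in>K. c i * x i)"
proof -
  have "gauss.indep_vars d (\<lambda>b. PiM (case_bool J K b) (\<lambda>_. borel))
      (\<lambda>b x. restrict (\<lambda>i. x i) (case_bool J K b)) UNIV"
    using assms by (intro gauss.indep_vars_restrict[OF gauss_components_indep])
      (auto split: bool.splits simp: disjoint_family_on_def)
  then have "gauss.indep_vars d (\<lambda>_. borel)
      (\<lambda>b x. \<Sum>i\<in>case_bool J K b. c i * restrict (\<lambda>i. x i) (case_bool J K b) i) UNIV"
    by (rule gauss.indep_vars_compose2[where Y = "\<lambda>b y. \<Sum>i\<in>case_bool J K b. c i * y i"]) simp
  then have "gauss.indep_vars d (\<lambda>_. borel) (\<lambda>b x. \<Sum>i\<in>case_bool J K b. c i * x i) UNIV"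
    by simp
  moreover have "(\<lambda>b x. \<Sum>i\<in>case_bool J K b. c i * x i) =
      case_bool (\<lambda>x. \<Sum>i\<in>J. c i * x i) (\<lambda>x. \<Sum>i\<in>K. c i * x i)"
    by (auto simp: fun_eq_iff split: bool.splits)
  moreover have "(\<lambda>_. borel) = case_bool borel (borel :: real measure)"
    by (auto simp: fun_eq_iff split: bool.splits)
  ultimately show ?thesis unfolding gauss.indep_var_def by simp
qed

text \<open>The unit vectors proportional to the vertices of the cube, indexed by their positive coordinates.\<close>
definition sign_vec :: "nat \<Rightarrow> nat set \<Rightarrow> point" where
  "sign_vec d A i = (if i \<in> A then 1 else - 1) / sqrt (real d)"

lemma sign_vec_nonzero: "0 < d \<Longrightarrow> sign_vec d A i \<noteq> 0"
  by (simp add: sign_vec_def)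

lemma sign_vec_square: "(sign_vec d A i)\<^sup>2 = 1 / real d"
  by (simp add: sign_vec_def power_divide)

lemma inner_sign_vec_distributed:
  assumes "0 < d"
  shows "distr (gauss d) borel (inner_d d (sign_vec d A)) = std_gauss"
proof -
  have "distributed (gauss d) lborel (\<lambda>x. \<Sum>i<d. sign_vec d A i * x i) std_normal_density"
    using gauss_linear_form_distributed[of d "{..<d}" "sign_vec d A"] assms
    by (auto simp: sign_vec_nonzero sign_vec_square lessThan_empty_iff)
  moreover have "distr (gauss d) borel (inner_d d (sign_vec d A)) = distr (gauss d) lborel (inner_d d (sign_vec d A))"
    by (rule distr_cong) auto
  ultimately show ?thesis by (simp add: distributed_def inner_d_def[abs_def])
qed

text \<open>Let P and Q be the parts of \<open>inner_d d (sign_vec d A) x\<close> over the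
  coordinates where the two vectors agree (\<open>J\<close>) and differ (\<open>K\<close>). The
  projections are P + Q and P - Q, with P and Q independent as they use disjoint coordinates, and
  their correlation \<open>(card J - card K) / d\<close> is \<rho>. This reduces the claim to
  \<open>mehler_bound\<close>; the normalization \<open>1 / sqrt (1 - \<rho>\<^sup>2)\<close> is at
  most 2 and turns the factor 2 into 4.\<close>

lemma pairwise_correlation_bound:
  fixes f :: "real \<Rightarrow> real"
  assumes d: "0 < d"
    and [measurable]: "f \<in> borel_measurable borel" and f1: "\<And>x. \<bar>f x\<bar> \<le> 1"
    and mom: "\<And>k. k < n \<Longrightarrow> integral\<^sup>L std_gauss (\<lambda>x. x ^ k * f x) = 0"
    and \<rho>: "\<bar>\<rho>\<bar> \<le> 1/8" "\<rho> = inner_d d (sign_vec d A) (sign_vec d B)"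
  shows "\<bar>\<integral>x. f (inner_d d (sign_vec d A) x) * f (inner_d d (sign_vec d B) x) \<partial>gauss d\<bar> \<le> 4 * (8 * \<bar>\<rho>\<bar>) ^ n"
proof -
  define J where "J = {i. i < d \<and> (i \<in> A \<longleftrightarrow> i \<in> B)}"
  define K where "K = {i. i < d \<and> \<not> (i \<in> A \<longleftrightarrow> i \<in> B)}"
  have JK: "J \<union> K = {..<d}" "J \<inter> K = {}" "finite J" "finite K" by (auto simp: J_def K_def)
  define \<sigma> \<tau> where "\<sigma> = sqrt (card J / real d)" and "\<tau> = sqrt (card K / real d)"
  have card: "real (card J) + real (card K) = real d"
    using card_Un_disjoint[of J K] JK by simp
  have one: "\<sigma>\<^sup>2 + \<tau>\<^sup>2 = 1"
    using card d by (simp add: \<sigma>_def \<tau>_def add_divide_distrib[symmetric])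
  have split: "(\<Sum>i<d. h i) = (\<Sum>i\<in>J. h i) + (\<Sum>i\<in>K. h i)" for h :: "nat \<Rightarrow> real"
    unfolding JK(1)[symmetric] using JK by (intro sum.union_disjoint) auto
  have inJ: "sign_vec d B i = sign_vec d A i" if "i \<in> J" for i using that by (auto simp: J_def sign_vec_def)
  have inK: "sign_vec d B i = - sign_vec d A i" if "i \<in> K" for i using that by (auto simp: K_def sign_vec_def)
  have \<rho>eq: "\<rho> = \<sigma>\<^sup>2 - \<tau>\<^sup>2"
  proof -
    have "\<rho> = (\<Sum>i\<in>J. (sign_vec d A i)\<^sup>2) + (\<Sum>i\<in>K. - (sign_vec d A i)\<^sup>2)"
      unfolding \<rho>(2) inner_d_def split by (simp add: inJ inK power2_eq_square cong: sum.cong)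
    then show ?thesis by (simp add: sign_vec_square \<sigma>_def \<tau>_def)
  qed
  \<comment> \<open>Two nearly orthogonal sign vectors neither coincide nor are opposite, so neither
    normal variable degenerates.\<close>
  have pos: "\<sigma>\<^sup>2 > 0" "\<tau>\<^sup>2 > 0" using \<rho>(1) one unfolding \<rho>eq by linarith+
  then have st: "0 < \<sigma>" "0 < \<tau>" by (auto simp: \<sigma>_def \<tau>_def)
  have ne: "J \<noteq> {}" "K \<noteq> {}" using pos by (auto simp: \<sigma>_def \<tau>_def)
  let ?P = "\<lambda>x::point. \<Sum>i\<in>J. sign_vec d A i * x i" and ?Q = "\<lambda>x::point. \<Sum>i\<in>K. sign_vec d A i * x i"
  have A: "inner_d d (sign_vec d A) x = ?P x + ?Q x" for x
    unfolding inner_d_def split ..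
  have B: "inner_d d (sign_vec d B) x = ?P x - ?Q x" for x
    unfolding inner_d_def split by (simp add: inJ inK sum_negf cong: sum.cong)
  have distr_eq: "distr (gauss d) borel h = distr (gauss d) lborel h" for h :: "point \<Rightarrow> real"
    by (rule distr_cong) auto
  have "distr (gauss d) borel ?P = density lborel (normal_density 0 \<sigma>)"
    using gauss_linear_form_distributed[of d J "sign_vec d A"] d ne JK(1)
    by (auto simp: distr_eq distributed_def sign_vec_nonzero sign_vec_square \<sigma>_def)
  moreover have "distr (gauss d) borel ?Q = density lborel (normal_density 0 \<tau>)"
    using gauss_linear_form_distributed[of d K "sign_vec d A"] d ne JK(1)
    by (auto simp: distr_eq distributed_def sign_vec_nonzero sign_vec_square \<tau>_def)
  ultimately have joint: "distr (gauss d) (borel \<Otimes>\<^sub>M borel) (\<lambda>x. (?P x, ?Q x)) =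
      density lborel (normal_density 0 \<sigma>) \<Otimes>\<^sub>M density lborel (normal_density 0 \<tau>)"
    and [measurable]: "?P \<in> borel_measurable (gauss d)" "?Q \<in> borel_measurable (gauss d)"
    using gauss_linear_forms_indep[of d J K "sign_vec d A"] d JK
    unfolding gauss.indep_var_distribution_eq by auto
  let ?w = "\<lambda>z. \<rho> / (1 - \<rho>\<^sup>2) * fst z * snd z - \<rho>\<^sup>2 / (2 * (1 - \<rho>\<^sup>2)) * ((fst z)\<^sup>2 + (snd z)\<^sup>2)"
  have "(\<integral>x. f (inner_d d (sign_vec d A) x) * f (inner_d d (sign_vec d B) x) \<partial>gauss d) =
      (\<integral>z. f (fst z + snd z) * f (fst z - snd z) \<partial>distr (gauss d) (borel \<Otimes>\<^sub>M borel) (\<lambda>x. (?P x, ?Q x)))"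
    unfolding A B by (subst integral_distr) simp_all
  also have "\<dots> = (\<integral>z. exp (?w z) / sqrt (1 - \<rho>\<^sup>2) * (f (fst z) * f (snd z)) \<partial>std_gauss2)"
    using integral_sum_diff_normal[OF st one, of "\<lambda>z. f (fst z) * f (snd z)"]
    unfolding joint \<rho>eq by simp
  also have "\<dots> = (\<integral>z. (f (fst z) * f (snd z) * exp (?w z)) / sqrt (1 - \<rho>\<^sup>2) \<partial>std_gauss2)"
    by (rule Bochner_Integration.integral_cong) simp_all
  also have "\<dots> = (\<integral>z. f (fst z) * f (snd z) * exp (?w z) \<partial>std_gauss2) / sqrt (1 - \<rho>\<^sup>2)"
    by (rule integral_divide_zero)
  finally have eq: "(\<integral>x. f (inner_d d (sign_vec d A) x) * f (inner_d d (sign_vec d B) x) \<partial>gauss d) =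
    (\<integral>z. f (fst z) * f (snd z) * exp (?w z) \<partial>std_gauss2) / sqrt (1 - \<rho>\<^sup>2)" .
  have sq: "sqrt (1 - \<rho>\<^sup>2) \<ge> 1/2"
  proof (rule real_le_rsqrt)
    have "\<rho>\<^sup>2 \<le> (1/8)\<^sup>2" using power_mono[OF \<rho>(1), of 2] by simp
    then show "(1/2)\<^sup>2 \<le> 1 - \<rho>\<^sup>2" by (simp add: power2_eq_square)
  qed
  have "\<bar>\<integral>z. f (fst z) * f (snd z) * exp (?w z) \<partial>std_gauss2\<bar> / sqrt (1 - \<rho>\<^sup>2) \<le>
      (2 * (8 * \<bar>\<rho>\<bar>) ^ n) / (1/2)"
    using mehler_bound[OF assms(2,3) mom \<rho>(1)] sq by (intro frac_le) auto
  then show ?thesis unfolding eq using sq by simp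
qed

section \<open>Concentration of inner products of sign vectors\<close>

lemma exp_plus_exp_minus_le:
  fixes x :: real
  assumes "0 \<le> x" "x \<le> 1"
  shows "exp x + exp (- x) \<le> 2 * exp (x\<^sup>2)"
proof -
  have "exp x \<le> 1 + x + x\<^sup>2" using exp_bound[OF assms] .
  moreover have "exp (- x) \<le> 1 - x + x\<^sup>2"
  proof -
    have "1 \<le> 1 + x ^ 3" using assms by simp
    also have "\<dots> = (1 + x) * (1 - x + x\<^sup>2)" by (simp add: algebra_simps power2_eq_square power3_eq_cube)
    also have "\<dots> \<le> exp x * (1 - x + x\<^sup>2)"
      using assms by (intro mult_right_mono exp_ge_add_one_self) auto
    finally show ?thesis by (simp add: exp_minus field_simps)
  qed
  moreover have "1 + x\<^sup>2 \<le> exp (x\<^sup>2)" by (rule exp_ge_add_one_self)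
  ultimately show ?thesis by linarith
qed

text \<open>Up to the factor \<open>2 ^ d\<close> this is the moment generating function of a sum of
  \<open>d\<close> independent fair signs: expanding a product of binary sums runs over the subsets
  \<open>B\<close>, and flipping coordinates according to \<open>A\<close> only swaps the two
  summands of a factor.\<close>

lemma sum_exp_sign_correlation:
  assumes d: "0 < d"
  shows "(\<Sum>B\<in>Pow {..<d}. exp (c * (real d * inner_d d (sign_vec d A) (sign_vec d B)))) = (exp c + exp (- c)) ^ d"
proof -
  let ?e = "\<lambda>A i. if i \<in> A then 1 else - 1 :: real"
  have "exp (c * (real d * inner_d d (sign_vec d A) (sign_vec d B))) =
      (\<Prod>i\<in>B. exp (c * ?e A i)) * (\<Prod>i\<in>{..<d} - B. exp (- (c * ?e A i)))" if B: "B \<subseteq> {..<d}" for B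
  proof -
    have "real d * inner_d d (sign_vec d A) (sign_vec d B) = (\<Sum>i<d. ?e A i * ?e B i)"
      using d unfolding inner_d_def sum_distrib_left
      by (intro sum.cong) (simp_all add: sign_vec_def)
    then have "exp (c * (real d * inner_d d (sign_vec d A) (sign_vec d B))) = exp (\<Sum>i<d. c * (?e A i * ?e B i))"
      by (simp add: sum_distrib_left)
    also have "\<dots> = (\<Prod>i<d. exp (c * (?e A i * ?e B i)))"
      by (simp add: exp_sum)
    also have "\<dots> = (\<Prod>i\<in>{..<d} - B. exp (c * (?e A i * ?e B i))) * (\<Prod>i\<in>B. exp (c * (?e A i * ?e B i)))"
      by (rule prod.subset_diff[OF B]) simp
    also have "(\<Prod>i\<in>B. exp (c * (?e A i * ?e B i))) = (\<Prod>i\<in>B. exp (c * ?e A i))"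
      by (intro prod.cong) auto
    also have "(\<Prod>i\<in>{..<d} - B. exp (c * (?e A i * ?e B i))) = (\<Prod>i\<in>{..<d} - B. exp (- (c * ?e A i)))"
      by (intro prod.cong) auto
    finally show ?thesis by (simp only: mult.commute)
  qed
  then have "(\<Sum>B\<in>Pow {..<d}. exp (c * (real d * inner_d d (sign_vec d A) (sign_vec d B)))) =
      (\<Sum>B\<in>Pow {..<d}. (\<Prod>i\<in>B. exp (c * ?e A i)) * (\<Prod>i\<in>{..<d} - B. exp (- (c * ?e A i))))"
    by (intro sum.cong) auto
  also have "\<dots> = (\<Prod>i<d. exp (c * ?e A i) + exp (- (c * ?e A i)))"
    by (rule prod_add[symmetric]) simp
  also have "\<dots> = (\<Prod>i<d. exp c + exp (- c))"
    by (intro prod.cong) auto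
  finally show ?thesis by simp
qed

lemma card_correlated_sign_vectors:
  assumes d: "0 < d" and r: "0 \<le> r" "r \<le> 1"
  shows "real (card {B \<in> Pow {..<d}. \<bar>inner_d d (sign_vec d A) (sign_vec d B)\<bar> > r}) \<le> 2 ^ d * (2 * exp (- (r\<^sup>2 * d / 4)))"
proof -
  define S where "S B = real d * inner_d d (sign_vec d A) (sign_vec d B)" for B
  let ?X = "{B \<in> Pow {..<d}. \<bar>inner_d d (sign_vec d A) (sign_vec d B)\<bar> > r}"
  \<comment> \<open>The Chernoff exponent \<open>- c * r * d + c\<^sup>2 * d\<close> is smallest
    here, with value \<open>- r\<^sup>2 * d / 4\<close>.\<close>
  let ?c = "r / 2"
  have "real (card ?X) = (\<Sum>B\<in>?X. 1)" by simp
  also have "\<dots> \<le> (\<Sum>B\<in>?X. exp (- (?c * (r * d))) * (exp (?c * S B) + exp (- ?c * S B)))"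
  proof (rule sum_mono)
    fix B assume "B \<in> ?X"
    then have "r * d \<le> \<bar>S B\<bar>"
      using d mult_left_mono[of r "\<bar>inner_d d (sign_vec d A) (sign_vec d B)\<bar>" "real d"]
      by (simp add: S_def abs_mult mult.commute)
    then have "exp (?c * (r * d)) \<le> exp (?c * \<bar>S B\<bar>)"
      using r(1) by (simp add: mult_left_mono)
    also have "\<dots> \<le> exp (?c * S B) + exp (- ?c * S B)"
      by (cases "S B \<ge> 0") auto
    finally show "1 \<le> exp (- (?c * (r * d))) * (exp (?c * S B) + exp (- ?c * S B))"
      by (simp add: exp_minus field_simps)
  qed
  also have "\<dots> \<le> (\<Sum>B\<in>Pow {..<d}. exp (- (?c * (r * d))) * (exp (?c * S B) + exp (- ?c * S B)))"
    by (intro sum_mono2) auto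
  also have "\<dots> = exp (- (?c * (r * d))) * (2 * (exp ?c + exp (- ?c)) ^ d)"
    using sum_exp_sign_correlation[OF d, of ?c A] sum_exp_sign_correlation[OF d, of "- ?c" A]
    unfolding sum_distrib_left[symmetric] sum.distrib S_def by (simp add: add.commute)
  also have "\<dots> \<le> exp (- (?c * (r * d))) * (2 * (2 * exp (?c\<^sup>2)) ^ d)"
    using exp_plus_exp_minus_le[of ?c] r by (intro mult_left_mono power_mono) auto
  also have "\<dots> = 2 ^ d * (2 * (exp (- (?c * (r * d))) * exp (d * ?c\<^sup>2)))"
    by (simp add: power_mult_distrib exp_of_nat_mult)
  also have "exp (- (?c * (r * d))) * exp (d * ?c\<^sup>2) = exp (- (r\<^sup>2 * d / 4))"
    unfolding mult_exp_exp by (simp add: power2_eq_square field_simps)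
  finally show ?thesis .
qed

lemma few_correlated_directions:
  fixes f :: "real \<Rightarrow> real"
  assumes d: "0 < d"
    and [measurable]: "f \<in> borel_measurable borel" and f1: "\<And>x. \<bar>f x\<bar> \<le> 1"
    and mom: "\<And>k. k < n \<Longrightarrow> integral\<^sup>L std_gauss (\<lambda>x. x ^ k * f x) = 0"
    and b[measurable]: "b \<in> borel_measurable (gauss d)" and b1: "\<And>x. \<bar>b x\<bar> \<le> 1"
    and r: "0 \<le> r" "r \<le> 1/8" and \<tau>: "0 < \<tau>" "8 * (8 * r) ^ n \<le> \<tau>\<^sup>2"
  shows "real (card {A \<in> Pow {..<d}. \<bar>\<integral>x. b x * f (inner_d d (sign_vec d A) x) \<partial>gauss d\<bar> > \<tau>})
      \<le> 2 ^ d * (4 * exp (- (r\<^sup>2 * d / 4)) / \<tau>\<^sup>2)"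
proof -
  \<comment> \<open>Second moment method: if \<open>b\<close> correlates with all signed \<open>F A\<close>, \<open>A \<in> S\<close>, it correlates with their sum,
    whose \<open>L\<^sup>2\<close> norm is small because most pairs of sign vectors are nearly orthogonal.\<close>
  define F where "F A x = f (inner_d d (sign_vec d A) x)" for A x
  have [measurable]: "F A \<in> borel_measurable (gauss d)" for A
    unfolding F_def[abs_def] by measurable
  have F1: "\<bar>F A x\<bar> \<le> 1" for A x using f1 by (simp add: F_def)
  have int: "integrable (gauss d) g" if "g \<in> borel_measurable (gauss d)" "\<And>x. \<bar>g x\<bar> \<le> C" for g :: "point \<Rightarrow> real" and C
    using that by (intro gauss.integrable_const_bound[where B = C]) auto
  have FF: "\<bar>F A x * F B x\<bar> \<le> 1" for A B x
    using mult_mono[OF F1[of A x] F1[of B x]] by (simp add: abs_mult)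
  have iFF: "integrable (gauss d) (\<lambda>x. F A x * F B x)" for A B
    by (rule int[OF _ FF]) simp
  define S where "S = {A \<in> Pow {..<d}. \<bar>\<integral>x. b x * F A x \<partial>gauss d\<bar> > \<tau>}"
  have fin: "finite S" unfolding S_def by simp
  let ?N = "real (card S)"
  define \<epsilon> where "\<epsilon> A = (if (\<integral>x. b x * F A x \<partial>gauss d) > 0 then 1 else - 1 :: real)" for A
  have \<epsilon>1: "\<bar>\<epsilon> A\<bar> = 1" for A by (simp add: \<epsilon>_def)
  define G where "G x = (\<Sum>A\<in>S. \<epsilon> A * F A x)" for x
  have [measurable]: "G \<in> borel_measurable (gauss d)" unfolding G_def[abs_def] by measurable
  have G1: "\<bar>G x\<bar> \<le> ?N" for x
  proof -
    have "\<bar>G x\<bar> \<le> (\<Sum>A\<in>S. \<bar>\<epsilon> A * F A x\<bar>)" unfolding G_def by (rule sum_abs)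
    also have "\<dots> \<le> (\<Sum>A\<in>S. 1)" using F1 by (intro sum_mono) (simp add: abs_mult \<epsilon>1)
    finally show ?thesis by simp
  qed
  have bG1: "\<bar>b x * G x\<bar> \<le> \<bar>G x\<bar>" for x
    using mult_right_mono[OF b1[of x], of "\<bar>G x\<bar>"] by (simp add: abs_mult)
  have iG2: "integrable (gauss d) (\<lambda>x. (G x)\<^sup>2)"
  proof (rule int)
    show "\<bar>(G x)\<^sup>2\<bar> \<le> ?N\<^sup>2" for x
      using power_mono[OF G1[of x], of 2] by simp
  qed simp
  have ibG: "integrable (gauss d) (\<lambda>x. b x * G x)"
    using order.trans[OF bG1 G1] by (intro int) auto
  have bG2: "(b x * G x)\<^sup>2 \<le> (G x)\<^sup>2" for x using bG1[of x] by (simp add: abs_le_square_iff)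
  have ibG2: "integrable (gauss d) (\<lambda>x. (b x * G x)\<^sup>2)"
    by (rule Bochner_Integration.integrable_bound[OF iG2]) (use bG2 in auto)
  have lower: "?N * \<tau> \<le> (\<integral>x. b x * G x \<partial>gauss d)"
  proof -
    have "(\<integral>x. b x * G x \<partial>gauss d) = (\<integral>x. (\<Sum>A\<in>S. \<epsilon> A * (b x * F A x)) \<partial>gauss d)"
      by (simp add: G_def sum_distrib_left mult_ac)
    also have "\<dots> = (\<Sum>A\<in>S. \<epsilon> A * (\<integral>x. b x * F A x \<partial>gauss d))"
    proof (subst Bochner_Integration.integral_sum)
      show "integrable (gauss d) (\<lambda>x. \<epsilon> A * (b x * F A x))" if "A \<in> S" for A
      proof (intro integrable_mult_right int[of _ 1])
        show "\<bar>b x * F A x\<bar> \<le> 1" for x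
          using mult_mono[OF b1[of x] F1[of A x]] by (simp add: abs_mult)
      qed simp
    qed simp
    also have "\<dots> \<ge> (\<Sum>A\<in>S. \<tau>)"
      by (rule sum_mono) (auto simp: S_def \<epsilon>_def)
    finally show ?thesis by simp
  qed
  have "(?N * \<tau>)\<^sup>2 \<le> (\<integral>x. b x * G x \<partial>gauss d)\<^sup>2"
    using lower \<tau>(1) by (intro power_mono) auto
  \<comment> \<open>Jensen's inequality for the square, read off from the nonnegativity of the
    variance.\<close>
  also have "\<dots> \<le> (\<integral>x. (b x * G x)\<^sup>2 \<partial>gauss d)"
    using gauss.variance_eq[OF ibG ibG2] gauss.variance_positive[of d "\<lambda>x. b x * G x"] by linarith
  also have "\<dots> \<le> (\<integral>x. (G x)\<^sup>2 \<partial>gauss d)"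
    by (intro integral_mono ibG2 iG2 bG2)
  also have "\<dots> = (\<integral>x. (\<Sum>A\<in>S. \<Sum>B\<in>S. \<epsilon> A * \<epsilon> B * (F A x * F B x)) \<partial>gauss d)"
    by (simp add: G_def power2_eq_square sum_product mult_ac)
  also have "\<dots> = (\<Sum>A\<in>S. \<Sum>B\<in>S. \<epsilon> A * \<epsilon> B * (\<integral>x. F A x * F B x \<partial>gauss d))"
    using iFF by (subst Bochner_Integration.integral_sum; (intro Bochner_Integration.integrable_sum)?)
      (auto intro!: sum.cong simp: Bochner_Integration.integral_sum)
  \<comment> \<open>For each \<open>A\<close>, strongly correlated \<open>B\<close> contribute at
    most 1 each and are few. The others contribute at most
    \<open>4 * (8 * r) ^ n \<le> \<tau>\<^sup>2 / 2\<close> each, in total at most half of the lower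
    bound \<open>(?N * \<tau>)\<^sup>2\<close>, which absorbs them.\<close>
  also have "\<dots> \<le> (\<Sum>A\<in>S. 2 ^ d * (2 * exp (- (r\<^sup>2 * d / 4))) + ?N * (\<tau>\<^sup>2 / 2))"
  proof (rule sum_mono)
    fix A assume "A \<in> S"
    have "(\<Sum>B\<in>S. \<epsilon> A * \<epsilon> B * (\<integral>x. F A x * F B x \<partial>gauss d)) \<le>
        (\<Sum>B\<in>S. indicator {B. \<bar>inner_d d (sign_vec d A) (sign_vec d B)\<bar> > r} B + \<tau>\<^sup>2 / 2)"
    proof (rule sum_mono)
      fix B
      have "\<epsilon> A * \<epsilon> B * (\<integral>x. F A x * F B x \<partial>gauss d) \<le> \<bar>\<integral>x. F A x * F B x \<partial>gauss d\<bar>"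
        using \<epsilon>1[of A] \<epsilon>1[of B] by (auto simp: \<epsilon>_def split: if_splits)
      also have "\<dots> \<le> indicator {B. \<bar>inner_d d (sign_vec d A) (sign_vec d B)\<bar> > r} B + \<tau>\<^sup>2 / 2"
      proof (cases "\<bar>inner_d d (sign_vec d A) (sign_vec d B)\<bar> > r")
        case True
        have "\<bar>\<integral>x. F A x * F B x \<partial>gauss d\<bar> \<le> (\<integral>x. \<bar>F A x * F B x\<bar> \<partial>gauss d)"
          by (rule integral_abs_bound)
        also have "\<dots> \<le> (\<integral>x. 1 \<partial>gauss d)"
          by (intro integral_mono integrable_abs iFF FF) simp
        also have "\<dots> = 1" by (simp add: gauss.prob_space)
        finally show ?thesis using True by (simp add: add_increasing2)
      next
        case False
        then have "\<bar>\<integral>x. F A x * F B x \<partial>gauss d\<bar> \<le> 4 * (8 * \<bar>inner_d d (sign_vec d A) (sign_vec d B)\<bar>) ^ n"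
          unfolding F_def using r by (intro pairwise_correlation_bound[OF d assms(2,3) mom]) auto
        also have "\<dots> \<le> 4 * (8 * r) ^ n"
          using False by (intro mult_left_mono power_mono) auto
        finally show ?thesis using \<tau>(2) False by simp
      qed
      finally show "\<epsilon> A * \<epsilon> B * (\<integral>x. F A x * F B x \<partial>gauss d) \<le>
        indicator {B. \<bar>inner_d d (sign_vec d A) (sign_vec d B)\<bar> > r} B + \<tau>\<^sup>2 / 2" .
    qed
    also have "\<dots> = real (card (S \<inter> {B. \<bar>inner_d d (sign_vec d A) (sign_vec d B)\<bar> > r})) + ?N * (\<tau>\<^sup>2 / 2)"
      using fin by (simp add: sum.distrib indicator_def)
    also have "real (card (S \<inter> {B. \<bar>inner_d d (sign_vec d A) (sign_vec d B)\<bar> > r})) \<le>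
        real (card {B \<in> Pow {..<d}. \<bar>inner_d d (sign_vec d A) (sign_vec d B)\<bar> > r})"
      by (intro of_nat_mono card_mono) (auto simp: S_def)
    also have "\<dots> \<le> 2 ^ d * (2 * exp (- (r\<^sup>2 * d / 4)))"
      using r by (intro card_correlated_sign_vectors d) auto
    finally show "(\<Sum>B\<in>S. \<epsilon> A * \<epsilon> B * (\<integral>x. F A x * F B x \<partial>gauss d)) \<le>
        2 ^ d * (2 * exp (- (r\<^sup>2 * d / 4))) + ?N * (\<tau>\<^sup>2 / 2)" by simp
  qed
  also have "\<dots> = ?N * (2 ^ d * (2 * exp (- (r\<^sup>2 * d / 4)))) + (?N * \<tau>)\<^sup>2 / 2"
    by (simp add: power2_eq_square algebra_simps)
  finally have "?N * (?N * \<tau>\<^sup>2) \<le> ?N * (2 ^ d * (4 * exp (- (r\<^sup>2 * d / 4))))"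
    by (simp add: power2_eq_square algebra_simps)
  then have "?N * \<tau>\<^sup>2 \<le> 2 ^ d * (4 * exp (- (r\<^sup>2 * d / 4)))"
    by (cases "card S = 0") auto
  then have "?N \<le> 2 ^ d * (4 * exp (- (r\<^sup>2 * d / 4)) / \<tau>\<^sup>2)"
    using \<tau>(1) by (simp add: field_simps)
  then show ?thesis by (simp add: S_def F_def)
qed

section \<open>Statistical query learners\<close>

abbreviation gauss_bool :: "nat \<Rightarrow> (point \<times> bool) measure" where
  "gauss_bool d \<equiv> gauss d \<Otimes>\<^sub>M count_space UNIV"

text \<open>Under \<open>labelled d \<phi>\<close> the label \<open>\<plusminus>1\<close> has conditional expectation \<open>\<phi> x\<close> given \<open>x\<close>.\<close>
definition labelled :: "nat \<Rightarrow> (point \<Rightarrow> real) \<Rightarrow> (point \<times> bool) measure" where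
  "labelled d \<phi> = density (gauss_bool d) (\<lambda>z. ennreal ((1 + (if snd z then 1 else - 1) * \<phi> (fst z)) / 2))"

lemma sets_labelled [measurable_cong, simp]: "sets (labelled d \<phi>) = sets (gauss_bool d)"
  by (simp add: labelled_def)

lemma nn_integral_labelled:
  assumes [measurable]: "\<phi> \<in> borel_measurable (gauss d)" "q \<in> borel_measurable (gauss_bool d)"
    and \<phi>1: "\<And>x. \<bar>\<phi> x\<bar> \<le> 1"
  shows "(\<integral>\<^sup>+z. q z \<partial>labelled d \<phi>) =
    (\<integral>\<^sup>+x. ennreal ((1 + \<phi> x) / 2) * q (x, True) + ennreal ((1 - \<phi> x) / 2) * q (x, False) \<partial>gauss d)"
proof -
  interpret B: sigma_finite_measure "count_space (UNIV :: bool set)"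
    by (rule sigma_finite_measure_count_space_finite) simp
  have "(\<integral>\<^sup>+z. q z \<partial>labelled d \<phi>) =
      (\<integral>\<^sup>+z. ennreal ((1 + (if snd z then 1 else - 1) * \<phi> (fst z)) / 2) * q z \<partial>gauss_bool d)"
    unfolding labelled_def by (rule nn_integral_density) simp_all
  also have "\<dots> = (\<integral>\<^sup>+x. \<integral>\<^sup>+y. ennreal ((1 + (if y then 1 else - 1) * \<phi> x) / 2) * q (x, y) \<partial>count_space UNIV \<partial>gauss d)"
    by (subst B.nn_integral_fst[symmetric]) simp_all
  finally show ?thesis
    by (simp add: nn_integral_count_space_finite UNIV_bool add.commute)
qed

lemma labelled_in_gauss_marginal_dists:
  assumes [measurable]: "\<phi> \<in> borel_measurable (gauss d)" and \<phi>1: "\<And>x. \<bar>\<phi> x\<bar> \<le> 1"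
  shows "labelled d \<phi> \<in> gauss_marginal_dists d"
proof -
  have half: "ennreal ((1 + \<phi> x) / 2) + ennreal ((1 - \<phi> x) / 2) = 1" for x
  proof -
    have "ennreal ((1 + \<phi> x) / 2) + ennreal ((1 - \<phi> x) / 2) = ennreal ((1 + \<phi> x) / 2 + (1 - \<phi> x) / 2)"
      using \<phi>1[of x] by (intro ennreal_plus[symmetric]) auto
    then show ?thesis by (simp add: field_simps)
  qed
  have nn: "(\<integral>\<^sup>+z. q (fst z) \<partial>labelled d \<phi>) = (\<integral>\<^sup>+x. q x \<partial>gauss d)" if [measurable]: "q \<in> borel_measurable (gauss d)" for q
    by (subst nn_integral_labelled) (simp_all add: \<phi>1 half distrib_right[symmetric])
  have "emeasure (labelled d \<phi>) (space (labelled d \<phi>)) = (\<integral>\<^sup>+z. 1 \<partial>labelled d \<phi>)" by simp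
  also have "\<dots> = 1" using nn[of "\<lambda>_. 1"] gauss.emeasure_space_1 by simp
  finally have "prob_space (labelled d \<phi>)" by (rule prob_spaceI)
  moreover have "distr (labelled d \<phi>) (gauss d) fst = gauss d"
  proof (rule measure_eqI)
    fix X assume "X \<in> sets (distr (labelled d \<phi>) (gauss d) fst)"
    then have [measurable]: "X \<in> sets (gauss d)" by simp
    have "emeasure (distr (labelled d \<phi>) (gauss d) fst) X = (\<integral>\<^sup>+x. indicator X x \<partial>distr (labelled d \<phi>) (gauss d) fst)"
      by simp
    also have "\<dots> = (\<integral>\<^sup>+z. indicator X (fst z) \<partial>labelled d \<phi>)"
      by (rule nn_integral_distr) simp_all
    also have "\<dots> = emeasure (gauss d) X" by (subst nn) simp_all
    finally show "emeasure (distr (labelled d \<phi>) (gauss d) fst) X = emeasure (gauss d) X" .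
  qed simp
  ultimately show ?thesis by (simp add: gauss_marginal_dists_def)
qed

text \<open>The part of \<open>q\<close> that is even in the label sees only the marginal, so the
  first integral is the answer for fair labels. Everything that a query can learn about
  \<open>\<phi>\<close> is the correlation with its odd part.\<close>

lemma integral_labelled:
  fixes q :: "point \<times> bool \<Rightarrow> real"
  assumes [measurable]: "\<phi> \<in> borel_measurable (gauss d)" "q \<in> borel_measurable (gauss_bool d)"
    and \<phi>1: "\<And>x. \<bar>\<phi> x\<bar> \<le> 1" and q1: "\<And>z. \<bar>q z\<bar> \<le> 1"
  shows "(\<integral>z. q z \<partial>labelled d \<phi>) = (\<integral>x. (q (x, True) + q (x, False)) / 2 \<partial>gauss d) +
    (\<integral>x. (q (x, True) - q (x, False)) / 2 * \<phi> x \<partial>gauss d)"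
proof -
  interpret B: finite_measure "count_space (UNIV :: bool set)"
    by (rule finite_measure_count_space) simp
  interpret P: pair_sigma_finite "gauss d" "count_space (UNIV :: bool set)" ..
  interpret PF: finite_measure "gauss_bool d"
    by (intro finite_measure_pair_measure gauss.finite_measure_axioms B.finite_measure_axioms)
  let ?p = "\<lambda>z. (1 + (if snd z then 1 else - 1) * \<phi> (fst z)) / 2"
  have p: "0 \<le> ?p z" "?p z \<le> 1" for z
    using \<phi>1[of "fst z"] by (auto simp: abs_le_iff)
  have int: "integrable (gauss_bool d) (\<lambda>z. ?p z *\<^sub>R q z)"
  proof (rule PF.integrable_const_bound)
    show "AE z in gauss_bool d. norm (?p z *\<^sub>R q z) \<le> 1"
    proof (rule always_eventually, rule allI)
      fix z
      have "?p z * \<bar>q z\<bar> \<le> 1 * 1" using p q1[of z] by (intro mult_mono) auto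
      then show "norm (?p z *\<^sub>R q z) \<le> 1" using p(1)[of z] by (simp add: abs_mult)
    qed
  qed simp
  have "(\<integral>z. q z \<partial>labelled d \<phi>) = (\<integral>z. ?p z *\<^sub>R q z \<partial>gauss_bool d)"
    unfolding labelled_def using p by (intro integral_density) auto
  also have "\<dots> = (\<integral>x. \<integral>y. ?p (x, y) *\<^sub>R q (x, y) \<partial>count_space UNIV \<partial>gauss d)"
    by (rule P.integral_fst'[symmetric, OF int])
  also have "\<dots> = (\<integral>x. (q (x, True) + q (x, False)) / 2 + (q (x, True) - q (x, False)) / 2 * \<phi> x \<partial>gauss d)"
    by (rule Bochner_Integration.integral_cong[OF refl])
      (simp add: lebesgue_integral_count_space_finite UNIV_bool field_simps)
  also have "\<dots> = (\<integral>x. (q (x, True) + q (x, False)) / 2 \<partial>gauss d) +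
    (\<integral>x. (q (x, True) - q (x, False)) / 2 * \<phi> x \<partial>gauss d)"
  proof (rule Bochner_Integration.integral_add)
    show "integrable (gauss d) (\<lambda>x. (q (x, True) + q (x, False)) / 2)"
    proof (rule gauss.integrable_const_bound)
      show "AE x in gauss d. norm ((q (x, True) + q (x, False)) / 2) \<le> 1"
      proof (rule always_eventually, rule allI)
        fix x
        show "norm ((q (x, True) + q (x, False)) / 2) \<le> 1"
          using q1[of "(x, True)"] q1[of "(x, False)"] by (simp add: abs_le_iff)
      qed
    qed simp
    show "integrable (gauss d) (\<lambda>x. (q (x, True) - q (x, False)) / 2 * \<phi> x)"
    proof (rule gauss.integrable_const_bound)
      show "AE x in gauss d. norm ((q (x, True) - q (x, False)) / 2 * \<phi> x) \<le> 1"
      proof (rule always_eventually, rule allI)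
        fix x
        have "\<bar>(q (x, True) - q (x, False)) / 2\<bar> \<le> 1"
          using q1[of "(x, True)"] q1[of "(x, False)"] by (simp add: abs_le_iff)
        then have "\<bar>(q (x, True) - q (x, False)) / 2\<bar> * \<bar>\<phi> x\<bar> \<le> 1 * 1"
          using \<phi>1[of x] by (intro mult_mono) auto
        then show "norm ((q (x, True) - q (x, False)) / 2 * \<phi> x) \<le> 1" by (simp add: abs_mult)
      qed
    qed simp
  qed
  finally show ?thesis .
qed

section \<open>Errors of hypotheses under the labelled distributions\<close>

lemma R_plus_labelled:
  assumes [measurable]: "\<phi> \<in> borel_measurable (gauss d)" "Measurable.pred (gauss d) h" and \<phi>1: "\<And>x. \<bar>\<phi> x\<bar> \<le> 1"
  shows "R_plus h (labelled d \<phi>) = (\<integral>x. of_bool (h x) / 2 \<partial>gauss d) - (\<integral>x. of_bool (h x) * \<phi> x \<partial>gauss d) / 2"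
proof -
  have "R_plus h (labelled d \<phi>) = (\<integral>z. of_bool (h (fst z) \<and> \<not> snd z) \<partial>labelled d \<phi>)"
  proof -
    have "(\<integral>z. of_bool (h (fst z) \<and> \<not> snd z) \<partial>labelled d \<phi>) =
        (\<integral>z. indicator {z. h (fst z) \<and> \<not> snd z} z \<partial>labelled d \<phi> :: real)"
      by (simp add: indicator_def)
    also have "\<dots> = R_plus h (labelled d \<phi>)"
      by (simp add: R_plus_def Int_def conj_ac)
    finally show ?thesis ..
  qed
  also have "\<dots> = (\<integral>x. of_bool (h x) / 2 \<partial>gauss d) + (\<integral>x. - of_bool (h x) / 2 * \<phi> x \<partial>gauss d)"
    by (subst integral_labelled) (simp_all add: \<phi>1)
  finally show ?thesis by simp
qed

lemma R_minus_labelled: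
  assumes [measurable]: "\<phi> \<in> borel_measurable (gauss d)" "Measurable.pred (gauss d) h" and \<phi>1: "\<And>x. \<bar>\<phi> x\<bar> \<le> 1"
  shows "R_minus h (labelled d \<phi>) = (\<integral>x. (1 + \<phi> x) / 2 \<partial>gauss d)
    - (\<integral>x. of_bool (h x) / 2 \<partial>gauss d) - (\<integral>x. of_bool (h x) * \<phi> x \<partial>gauss d) / 2"
proof -
  have bi: "integrable (gauss d) g" if "g \<in> borel_measurable (gauss d)" "\<And>x. \<bar>g x\<bar> \<le> 1" for g :: "point \<Rightarrow> real"
    using that by (intro gauss.integrable_const_bound[where B = 1]) auto
  have i: "integrable (gauss d) \<phi>" "integrable (gauss d) (\<lambda>x. of_bool (h x) :: real)"
    "integrable (gauss d) (\<lambda>x. of_bool (h x) * \<phi> x)"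
  proof -
    show "integrable (gauss d) \<phi>" by (rule bi) (simp_all add: \<phi>1)
    show "integrable (gauss d) (\<lambda>x. of_bool (h x) :: real)" by (rule bi) simp_all
    show "integrable (gauss d) (\<lambda>x. of_bool (h x) * \<phi> x)" by (rule bi) (simp_all add: \<phi>1 of_bool_def)
  qed
  have "R_minus h (labelled d \<phi>) = (\<integral>z. of_bool (\<not> h (fst z) \<and> snd z) \<partial>labelled d \<phi>)"
  proof -
    have "(\<integral>z. of_bool (\<not> h (fst z) \<and> snd z) \<partial>labelled d \<phi>) =
        (\<integral>z. indicator {z. \<not> h (fst z) \<and> snd z} z \<partial>labelled d \<phi> :: real)"
      by (simp add: indicator_def)
    also have "\<dots> = R_minus h (labelled d \<phi>)"
      by (simp add: R_minus_def Int_def conj_ac)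
    finally show ?thesis ..
  qed
  also have "\<dots> = (\<integral>x. of_bool (\<not> h x) / 2 \<partial>gauss d) + (\<integral>x. of_bool (\<not> h x) / 2 * \<phi> x \<partial>gauss d)"
    by (subst integral_labelled) (simp_all add: \<phi>1)
  also have "(\<integral>x. of_bool (\<not> h x) / 2 \<partial>gauss d :: real) = (\<integral>x. 1 / 2 - of_bool (h x) / 2 \<partial>gauss d)"
    by (rule Bochner_Integration.integral_cong) (auto simp: of_bool_def)
  also have "\<dots> = 1 / 2 - (\<integral>x. of_bool (h x) / 2 \<partial>gauss d)"
    using i by (subst Bochner_Integration.integral_diff) (simp_all add: gauss.prob_space)
  also have "(\<integral>x. of_bool (\<not> h x) / 2 * \<phi> x \<partial>gauss d) = (\<integral>x. \<phi> x / 2 - of_bool (h x) * \<phi> x / 2 \<partial>gauss d)"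
    by (rule Bochner_Integration.integral_cong) (auto simp: of_bool_def)
  also have "\<dots> = (\<integral>x. \<phi> x \<partial>gauss d) / 2 - (\<integral>x. of_bool (h x) * \<phi> x \<partial>gauss d) / 2"
    using i by (subst Bochner_Integration.integral_diff) simp_all
  finally show ?thesis
    using i by (simp add: gauss.prob_space add_divide_distrib)
qed

lemma measurable_halfspace [measurable]: "Measurable.pred (gauss d) (halfspace d w t)"
  unfolding halfspace_def by measurable

text \<open>The halfspace competes in \<open>OPT\<close> because all labels on it are positive. Let
  p be the probability of \<open>h\<close> and c its correlation with \<phi>. Comparing false
  negatives with the halfspace gives \<alpha> \<le> (p + c) / 2 + \<epsilon>, and the bound on false
  positives gives (p - c) / 2 \<le> \<epsilon>. Adding the two eliminates p, so a trivially large or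
  small \<open>h\<close> cannot succeed.\<close>

lemma reliable_output_correlates:
  assumes \<phi>[measurable]: "\<phi> \<in> borel_measurable (gauss d)" and \<phi>1: "\<And>x. \<bar>\<phi> x\<bar> \<le> 1"
    and \<alpha>: "\<alpha> \<le> 1/2" "measure (gauss d) {x \<in> space (gauss d). halfspace d w t x} = \<alpha>"
    and one: "\<And>x. halfspace d w t x \<Longrightarrow> \<phi> x = 1"
    and rel: "reliable_output \<alpha> d \<epsilon> (labelled d \<phi>) h"
  shows "\<alpha> - 2 * \<epsilon> \<le> (\<integral>x. of_bool (h x) * \<phi> x \<partial>gauss d)"
proof -
  let ?D = "labelled d \<phi>" and ?H = "halfspace d w t"
  have [measurable]: "Measurable.pred (gauss d) h" and p: "R_plus h ?D \<le> \<epsilon>" and m: "R_minus h ?D \<le> OPT \<alpha> d ?D + \<epsilon>"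
    using rel by (auto simp: reliable_output_def)
  have "(\<integral>x. of_bool (?H x) \<partial>gauss d) = (\<integral>x. indicator {x. ?H x} x \<partial>gauss d :: real)"
    by (simp add: indicator_def)
  then have Hint: "(\<integral>x. of_bool (?H x) \<partial>gauss d) = \<alpha>"
    using \<alpha>(2) by (simp add: Int_def conj_ac)
  have "(\<integral>x. of_bool (?H x) * \<phi> x \<partial>gauss d) = (\<integral>x. of_bool (?H x) \<partial>gauss d)"
    using one by (intro Bochner_Integration.integral_cong) auto
  then have H\<phi>: "(\<integral>x. of_bool (?H x) * \<phi> x \<partial>gauss d) = \<alpha>" using Hint by simp
  have "measure (gauss d) {x \<in> space (gauss d). \<not> ?H x} = 1 - \<alpha>"
    using gauss.prob_neg[of d "?H"] \<alpha>(2) by simp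
  then have "?H \<in> biased_halfspaces \<alpha> d"
    using \<alpha> unfolding biased_halfspaces_def by auto
  moreover have "R_plus ?H ?D = 0"
    using R_plus_labelled[OF \<phi> measurable_halfspace \<phi>1] Hint H\<phi> by simp
  ultimately have "OPT \<alpha> d ?D \<le> R_minus ?H ?D"
    unfolding OPT_def by (intro cInf_lower) (auto intro!: bdd_belowI[of _ 0] simp: R_minus_def)
  then have "R_minus h ?D \<le> R_minus ?H ?D + \<epsilon>" using m by simp
  then have "\<alpha> \<le> (\<integral>x. of_bool (h x) / 2 \<partial>gauss d) + (\<integral>x. of_bool (h x) * \<phi> x \<partial>gauss d) / 2 + \<epsilon>"
    using R_minus_labelled[OF \<phi> measurable_halfspace \<phi>1] R_minus_labelled[OF \<phi> _ \<phi>1, of h] Hint H\<phi> by simp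
  moreover have "(\<integral>x. of_bool (h x) / 2 \<partial>gauss d) - (\<integral>x. of_bool (h x) * \<phi> x \<partial>gauss d) / 2 \<le> \<epsilon>"
    using p R_plus_labelled[OF \<phi> _ \<phi>1, of h] by simp
  ultimately show ?thesis by linarith
qed

section \<open>Runs of query algorithms and the counting of directions\<close>

lemma sq_hist_cong:
  assumes "\<And>j q. j < k \<Longrightarrow> A (sq_hist A orc' j) = Inl q \<Longrightarrow> orc q = orc' q"
  shows "sq_hist A orc k = sq_hist A orc' k"
  using assms
proof (induction k)
  case (Suc k)
  then have "sq_hist A orc k = sq_hist A orc' k" by (meson less_SucI)
  then show ?case
    using Suc.prems[of k] by (cases "A (sq_hist A orc' k)") (simp_all add: Let_def)
qed simp

text \<open>Before the first differing answer both runs coincide, so the query that separates them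
  is asked in the run against \<open>orc'\<close>. When \<open>orc'\<close> is fixed and
  \<open>orc\<close> varies with the hidden direction, only the queries of that one run need to be
  examined.\<close>

lemma sq_run_change_oracle:
  assumes "sq_run A orc m \<tau> h"
  shows "(\<exists>j<m. \<exists>q. A (sq_hist A orc' j) = Inl q \<and> snd q > \<tau> \<and> orc q \<noteq> orc' q) \<or> sq_run A orc' m \<tau> h"
proof -
  obtain k where k: "k \<le> m" "A (sq_hist A orc k) = Inr h"
    "\<And>j. j < k \<Longrightarrow> \<exists>q. A (sq_hist A orc j) = Inl q \<and> snd q > \<tau>"
    using assms unfolding sq_run_def by auto
  let ?P = "\<lambda>j. j < k \<and> (\<exists>q. A (sq_hist A orc' j) = Inl q \<and> orc q \<noteq> orc' q)"
  show ?thesis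
  proof (cases "\<exists>j. ?P j")
    case False
    have "sq_hist A orc j = sq_hist A orc' j" if "j \<le> k" for j
      by (rule sq_hist_cong) (meson False order_less_le_trans that)
    then show ?thesis using k unfolding sq_run_def by auto
  next
    case True
    define j where "j = (LEAST j. ?P j)"
    have j: "?P j" unfolding j_def using True by (rule LeastI_ex)
    have "sq_hist A orc j = sq_hist A orc' j"
    proof (rule sq_hist_cong)
      fix i q assume "i < j" "A (sq_hist A orc' i) = Inl q"
      then show "orc q = orc' q" using j not_less_Least[of i ?P] unfolding j_def by auto
    qed
    then show ?thesis using j k by (metis order_less_le_trans sum.inject(1))
  qed
qed

text \<open>This turns the output of the run against a fixed oracle into a single test function,
  shared by all hidden directions that the run does not detect.\<close>

lemma sq_run_unique:
  assumes "sq_run A orc m \<tau> h" "sq_run A orc m \<tau> h'"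
  shows "h = h'"
proof -
  obtain k k' where "A (sq_hist A orc k) = Inr h" "\<forall>j<k. \<exists>q. A (sq_hist A orc j) = Inl q"
    "A (sq_hist A orc k') = Inr h'" "\<forall>j<k'. \<exists>q. A (sq_hist A orc j) = Inl q"
    using assms unfolding sq_run_def by metis
  then show ?thesis by (metis linorder_neqE_nat sum.distinct(1) sum.inject(2))
qed

text \<open>Double counting of pairs of a seed and a direction. Every direction is learned for seeds
  of measure at least \<open>2/3\<close>. A fixed seed serves a direction only if one of the at most
  \<open>m\<close> queries of its run against \<open>orc0\<close>, or its output there, correlates
  with that direction by more than \<tau>, and each of these functions does so for few directions.
  The condition \<tau> < \<alpha> - 2 * \<epsilon> is what makes a reliable output correlate
  enough.\<close>

lemma sq_query_lower_bound:
  fixes f :: "real \<Rightarrow> real" and \<A> :: "'r \<Rightarrow> sq_alg"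
  assumes d: "0 < d"
    and f[measurable]: "f \<in> borel_measurable borel" and f1: "\<And>x. \<bar>f x\<bar> \<le> 1"
    and mom: "\<And>k. k < n \<Longrightarrow> integral\<^sup>L std_gauss (\<lambda>x. x ^ k * f x) = 0"
    and fT: "\<And>x. x \<ge> T \<Longrightarrow> f x = 1" and \<alpha>: "measure std_gauss {T..} = \<alpha>" "\<alpha> \<le> 1/2"
    and r: "0 \<le> r" "r \<le> 1/8" and \<tau>: "0 < \<tau>" "8 * (8 * r) ^ n \<le> \<tau>\<^sup>2" "\<tau> < \<alpha> - 2 * \<epsilon>"
    and learns: "sq_reliably_learns R \<A> \<alpha> d \<epsilon> m \<tau>"
  shows "2 / 3 \<le> (real m + 1) * (4 * exp (- (r\<^sup>2 * d / 4)) / \<tau>\<^sup>2)"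
proof -
  define \<phi> where "\<phi> V x = f (inner_d d (sign_vec d V) x)" for V x
  have \<phi>[measurable]: "\<phi> V \<in> borel_measurable (gauss d)" for V unfolding \<phi>_def[abs_def] by measurable
  have \<phi>1: "\<bar>\<phi> V x\<bar> \<le> 1" for V x using f1 by (simp add: \<phi>_def)
  define valid where "valid q \<longleftrightarrow> q \<in> borel_measurable (gauss_bool d) \<and> (\<forall>z. \<bar>q z\<bar> \<le> 1)" for q :: "point \<times> bool \<Rightarrow> real"
  define null where "null q = (\<integral>x. (q (x, True) + q (x, False)) / 2 \<partial>gauss d)" for q :: "point \<times> bool \<Rightarrow> real"
  define E where "E V q = (\<integral>z. q z \<partial>labelled d (\<phi> V))" for V and q :: "point \<times> bool \<Rightarrow> real"
  \<comment> \<open>\<open>orc V\<close> answers as if the labels were fair coins whenever this is within the tolerance.\<close>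
  define orc0 where "orc0 = (\<lambda>(q, t :: real). null q)"
  define orc where "orc V = (\<lambda>(q, t). if valid q \<and> \<bar>E V q - null q\<bar> > t then E V q else null q)" for V
  define far where "far b = {V \<in> Pow {..<d}. \<bar>\<integral>x. b x * \<phi> V x \<partial>gauss d\<bar> > \<tau>}" for b
  let ?\<kappa> = "2 ^ d * (4 * exp (- (r\<^sup>2 * d / 4)) / \<tau>\<^sup>2)"
  have far: "real (card (far b)) \<le> ?\<kappa>" if "b \<in> borel_measurable (gauss d)" "\<And>x. \<bar>b x\<bar> \<le> 1" for b
    unfolding far_def \<phi>_def using that by (intro few_correlated_directions[OF d f f1 mom _ _ r \<tau>(1,2)])
  have \<kappa>0: "0 \<le> ?\<kappa>" by simp
  have prob: "prob_space R"
    using learns by (simp add: sq_reliably_learns_def)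
  interpret R: prob_space R by (rule prob)
  have "\<exists>S \<in> sets R. measure R S \<ge> 2/3 \<and>
      (\<forall>s \<in> S. \<exists>h. sq_run (\<A> s) (orc V) m \<tau> h \<and> reliable_output \<alpha> d \<epsilon> (labelled d (\<phi> V)) h)" for V
  proof -
    have "valid_oracle (labelled d (\<phi> V)) (orc V)"
      by (auto simp: valid_oracle_def orc_def valid_def E_def measurable_cong_sets[OF sets_labelled refl])
    then show ?thesis
      using learns labelled_in_gauss_marginal_dists[OF \<phi> \<phi>1] unfolding sq_reliably_learns_def by blast
  qed
  then obtain S where S: "\<And>V. S V \<in> sets R" "\<And>V. measure R (S V) \<ge> 2/3"
    "\<And>V s. s \<in> S V \<Longrightarrow> \<exists>h. sq_run (\<A> s) (orc V) m \<tau> h \<and> reliable_output \<alpha> d \<epsilon> (labelled d (\<phi> V)) h"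
    by metis
  have iS: "integrable R (\<lambda>s. indicator (S V) s :: real)" for V
    using S(1) by (intro R.integrable_const_bound[where B = 1]) auto
  have few: "real (card {V \<in> Pow {..<d}. s \<in> S V}) \<le> (real m + 1) * ?\<kappa>" for s
  proof -
    define Q where "Q j = {V \<in> Pow {..<d}. \<exists>q. \<A> s (sq_hist (\<A> s) orc0 j) = Inl q \<and> snd q > \<tau> \<and> orc V q \<noteq> orc0 q}" for j
    define Out where "Out = {V \<in> Pow {..<d}. \<exists>h. sq_run (\<A> s) orc0 m \<tau> h \<and> reliable_output \<alpha> d \<epsilon> (labelled d (\<phi> V)) h}"
    have "{V \<in> Pow {..<d}. s \<in> S V} \<subseteq> (\<Union>j<m. Q j) \<union> Out"
    proof
      fix V assume V: "V \<in> {V \<in> Pow {..<d}. s \<in> S V}"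
      then obtain h where "sq_run (\<A> s) (orc V) m \<tau> h" "reliable_output \<alpha> d \<epsilon> (labelled d (\<phi> V)) h"
        using S(3) by blast
      with sq_run_change_oracle[OF this(1), of orc0] V show "V \<in> (\<Union>j<m. Q j) \<union> Out"
        unfolding Q_def Out_def by blast
    qed
    moreover have fin: "finite (Q j)" "finite Out" for j by (simp_all add: Q_def Out_def)
    ultimately have "card {V \<in> Pow {..<d}. s \<in> S V} \<le> card ((\<Union>j<m. Q j) \<union> Out)"
      by (intro card_mono) auto
    also have "\<dots> \<le> card (\<Union>j<m. Q j) + card Out" by (rule card_Un_le)
    also have "\<dots> \<le> (\<Sum>j<m. card (Q j)) + card Out" by (intro add_right_mono card_UN_le) simp
    finally have "real (card {V \<in> Pow {..<d}. s \<in> S V}) \<le> (\<Sum>j<m. real (card (Q j))) + real (card Out)"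
      by (simp flip: of_nat_sum of_nat_add)
    also have "\<dots> \<le> (\<Sum>j<m. ?\<kappa>) + ?\<kappa>"
    proof (intro add_mono sum_mono)
      fix j
      show "real (card (Q j)) \<le> ?\<kappa>"
      proof (cases "\<exists>q t. \<A> s (sq_hist (\<A> s) orc0 j) = Inl (q, t) \<and> t > \<tau> \<and> valid q")
        case True
        then obtain q t where q: "\<A> s (sq_hist (\<A> s) orc0 j) = Inl (q, t)" "t > \<tau>" "valid q" by blast
        have [measurable]: "q \<in> borel_measurable (gauss_bool d)" and q1: "\<And>z. \<bar>q z\<bar> \<le> 1"
          using q(3) by (auto simp: valid_def)
        let ?b = "\<lambda>x. (q (x, True) - q (x, False)) / 2"
        have "Q j \<subseteq> far ?b"
        proof
          fix V assume "V \<in> Q j"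
          then have V: "V \<in> Pow {..<d}" "\<bar>E V q - null q\<bar> > t"
            using q by (auto simp: Q_def orc_def orc0_def split: if_splits)
          have "E V q - null q = (\<integral>x. ?b x * \<phi> V x \<partial>gauss d)"
            unfolding E_def null_def by (subst integral_labelled) (simp_all add: \<phi>1 q1)
          then show "V \<in> far ?b" using V q(2) by (simp add: far_def)
        qed
        then have "card (Q j) \<le> card (far ?b)" by (intro card_mono) (auto simp: far_def)
        moreover have "real (card (far ?b)) \<le> ?\<kappa>"
        proof (rule far)
          show "\<bar>?b x\<bar> \<le> 1" for x
            using q1[of "(x, True)"] q1[of "(x, False)"] by (simp add: abs_le_iff)
        qed simp
        ultimately show ?thesis by linarith
      next
        case False
        \<comment> \<open>Without an admissible query at this step there is nothing to detect: to an
          invalid \<open>q\<close>, \<open>orc V\<close> gives the answer \<open>null q\<close> for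
          every \<open>V\<close>.\<close>
        then have "Q j = {}" by (auto simp: Q_def orc_def orc0_def split: if_splits)
        then show ?thesis using \<kappa>0 by simp
      qed
    next
      show "real (card Out) \<le> ?\<kappa>"
      proof (cases "Out = {}")
        case False
        then obtain h V0 where h: "sq_run (\<A> s) orc0 m \<tau> h" "reliable_output \<alpha> d \<epsilon> (labelled d (\<phi> V0)) h"
          unfolding Out_def by blast
        have [measurable]: "Measurable.pred (gauss d) h" using h(2) by (simp add: reliable_output_def)
        have "Out \<subseteq> far (\<lambda>x. of_bool (h x))"
        proof
          fix V assume "V \<in> Out"
          then obtain h' where h': "V \<in> Pow {..<d}" "sq_run (\<A> s) orc0 m \<tau> h'" "reliable_output \<alpha> d \<epsilon> (labelled d (\<phi> V)) h'"
            unfolding Out_def by blast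
          with sq_run_unique[OF h(1)] have rel: "reliable_output \<alpha> d \<epsilon> (labelled d (\<phi> V)) h" by blast
          have "measure (gauss d) {x \<in> space (gauss d). halfspace d (sign_vec d V) T x} =
              measure (distr (gauss d) borel (inner_d d (sign_vec d V))) {T..}"
            by (subst measure_distr) (auto simp: halfspace_def intro!: arg_cong2[where f = measure])
          then have "measure (gauss d) {x \<in> space (gauss d). halfspace d (sign_vec d V) T x} = \<alpha>"
            using inner_sign_vec_distributed[OF d] \<alpha>(1) by simp
          from reliable_output_correlates[OF \<phi> \<phi>1 \<alpha>(2) this _ rel]
          have "\<alpha> - 2 * \<epsilon> \<le> (\<integral>x. of_bool (h x) * \<phi> V x \<partial>gauss d)"
            by (simp add: \<phi>_def halfspace_def fT)
          then show "V \<in> far (\<lambda>x. of_bool (h x))" using h'(1) \<tau>(3) by (simp add: far_def)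
        qed
        then have "card Out \<le> card (far (\<lambda>x. of_bool (h x)))" by (intro card_mono) (auto simp: far_def)
        moreover have "real (card (far (\<lambda>x. of_bool (h x)))) \<le> ?\<kappa>" by (rule far) simp_all
        ultimately show ?thesis by linarith
      qed (use \<kappa>0 in simp)
    qed
    finally show ?thesis by (simp add: distrib_right add_divide_distrib)
  qed
  have "2 ^ d * (2 / 3) = (\<Sum>V\<in>Pow {..<d}. 2 / 3 :: real)" by (simp add: card_Pow)
  also have "\<dots> \<le> (\<Sum>V\<in>Pow {..<d}. measure R (S V))" by (intro sum_mono S(2))
  also have "\<dots> = (\<Sum>V\<in>Pow {..<d}. \<integral>s. indicator (S V) s \<partial>R)"
    using S(1) by (simp add: Int_absorb2 sets.sets_into_space)
  also have "\<dots> = (\<integral>s. (\<Sum>V\<in>Pow {..<d}. indicator (S V) s) \<partial>R)"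
    using iS by (subst Bochner_Integration.integral_sum) auto
  also have "\<dots> \<le> (\<integral>s. (real m + 1) * ?\<kappa> \<partial>R)"
  proof (rule integral_mono)
    show "integrable R (\<lambda>s. \<Sum>V\<in>Pow {..<d}. indicator (S V) s :: real)"
      by (intro Bochner_Integration.integrable_sum iS)
    show "(\<Sum>V\<in>Pow {..<d}. indicator (S V) s) \<le> (real m + 1) * ?\<kappa>" for s
    proof -
      have "(\<Sum>V\<in>Pow {..<d}. indicator (S V) s) = real (card {V \<in> Pow {..<d}. s \<in> S V})"
        by (simp add: indicator_def Int_def)
      then show ?thesis using few[of s] by simp
    qed
  qed simp
  also have "\<dots> = 2 ^ d * ((real m + 1) * (4 * exp (- (r\<^sup>2 * d / 4)) / \<tau>\<^sup>2))"
    by (simp add: R.prob_space)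
  finally show ?thesis by (rule mult_left_le_imp_le) simp
qed

text \<open>With \<open>r = d powr (- 1/4)\<close>, the power \<open>(8 * r) powr (L / 200)\<close>
  is of order \<open>d powr (- L / 800)\<close>, while the squared tolerance is
  \<open>d powr (- L / 1600)\<close>; the spare factor \<open>d powr (- L / 1600)\<close> absorbs
  the constants. Further, \<open>r\<^sup>2 * d / 4\<close> is \<open>sqrt d / 4\<close>, whose
  exponential beats both \<open>2 powr (d powr (1/4))\<close> and the polynomial factor from the
  tolerance.\<close>

lemma eventually_parameters:
  fixes L \<alpha> :: real
  assumes "L > 0" "\<alpha> > 0"
  shows "eventually (\<lambda>d::nat. 0 < d \<and> real d powr (- 1/4) \<le> 1/8 \<and>
      8 * (8 * real d powr (- 1/4)) powr (L / 200) \<le> (real d powr (- (1/3200) * L))\<^sup>2 \<and>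
      real d powr (- (1/3200) * L) < \<alpha> / 3 \<and>
      (2 powr (real d powr (1/4)) + 1) * (4 * exp (- ((real d powr (- 1/4))\<^sup>2 * d / 4)) / (real d powr (- (1/3200) * L))\<^sup>2) < 2 / 3)
    at_top"
  using assms by (intro eventually_conj; real_asymp)

theorem theoremC1:
  "\<exists>\<alpha>0 > 0. \<exists>c1 > 0. \<exists>c2 > (0::real). \<forall>\<alpha>. 0 < \<alpha> \<and> \<alpha> \<le> \<alpha>0 \<longrightarrow>
     (\<exists>d0. \<forall>d \<ge> d0. \<forall>\<epsilon>. 0 < \<epsilon> \<and> \<epsilon> < \<alpha> / 3 \<longrightarrow>
        (\<forall>(R :: (nat \<Rightarrow> bool) measure) A m.
           sq_reliably_learns R A \<alpha> d \<epsilon> m (real d powr (- c1 * ln (1 / \<alpha>))) \<longrightarrow>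
           real m \<ge> 2 powr (real d powr c2)))"
proof (rule exI[of _ "exp (- 100)"], rule conjI, simp, rule exI[of _ "1 / 3200"], rule conjI, simp,
    rule exI[of _ "1 / 4"], rule conjI, simp, intro allI impI)
  fix \<alpha> :: real
  assume "0 < \<alpha> \<and> \<alpha> \<le> exp (- 100)"
  then have \<alpha>: "0 < \<alpha>" "\<alpha> \<le> exp (- 100)" by auto
  have "exp (- 100) \<le> inverse (1 + 100 :: real)"
    unfolding exp_minus by (intro le_imp_inverse_le exp_ge_add_one_self) simp
  then have \<alpha>2: "\<alpha> \<le> 1/2" using \<alpha>(2) by simp
  define L where "L = ln (1 / \<alpha>)"
  have "L > 0" using \<alpha>(1) \<alpha>2 by (simp add: L_def)
  obtain T n and f :: "real \<Rightarrow> real" where prof: "real n \<ge> L / 200" "measure std_gauss {T..} = \<alpha>"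
    "f \<in> borel_measurable borel" "\<And>x. \<bar>f x\<bar> \<le> 1" "\<And>x. x \<ge> T \<Longrightarrow> f x = 1"
    "\<And>k. k < n \<Longrightarrow> integral\<^sup>L std_gauss (\<lambda>x. x ^ k * f x) = 0"
    by (rule hidden_direction_profile[OF \<alpha>, folded L_def]) (rule that)
  from eventually_parameters[OF \<open>L > 0\<close> \<alpha>(1)] obtain d0 where
    d0: "\<And>d. d \<ge> d0 \<Longrightarrow> 0 < d \<and> real d powr (- 1/4) \<le> 1/8 \<and>
      8 * (8 * real d powr (- 1/4)) powr (L / 200) \<le> (real d powr (- (1/3200) * L))\<^sup>2 \<and>
      real d powr (- (1/3200) * L) < \<alpha> / 3 \<and>
      (2 powr (real d powr (1/4)) + 1) * (4 * exp (- ((real d powr (- 1/4))\<^sup>2 * d / 4)) / (real d powr (- (1/3200) * L))\<^sup>2) < 2 / 3"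
    unfolding eventually_at_top_linorder by blast
  show "\<exists>d0. \<forall>d \<ge> d0. \<forall>\<epsilon>. 0 < \<epsilon> \<and> \<epsilon> < \<alpha> / 3 \<longrightarrow>
        (\<forall>(R :: (nat \<Rightarrow> bool) measure) A m.
           sq_reliably_learns R A \<alpha> d \<epsilon> m (real d powr (- (1/3200) * ln (1 / \<alpha>))) \<longrightarrow>
           real m \<ge> 2 powr (real d powr (1/4)))"
  proof (intro exI[of _ d0] allI impI)
    fix d \<epsilon> and R :: "(nat \<Rightarrow> bool) measure" and A m
    assume "d0 \<le> d" and \<epsilon>: "0 < \<epsilon> \<and> \<epsilon> < \<alpha> / 3"
      and learns: "sq_reliably_learns R A \<alpha> d \<epsilon> m (real d powr (- (1/3200) * ln (1 / \<alpha>)))"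
    define r where "r = real d powr (- 1/4)"
    define \<tau> where "\<tau> = real d powr (- (1/3200) * L)"
    have d: "0 < d" "r \<le> 1/8" "8 * (8 * r) powr (L / 200) \<le> \<tau>\<^sup>2" "\<tau> < \<alpha> / 3"
      "(2 powr (real d powr (1/4)) + 1) * (4 * exp (- (r\<^sup>2 * d / 4)) / \<tau>\<^sup>2) < 2 / 3"
      using d0[OF \<open>d0 \<le> d\<close>] by (auto simp: r_def \<tau>_def)
    have r0: "0 < r" and \<tau>0: "0 < \<tau>" using d(1) by (simp_all add: r_def \<tau>_def)
    have "(8 * r) ^ n = (8 * r) powr real n" using r0 by (simp add: powr_realpow)
    \<comment> \<open>The base is at most 1, so passing to the smaller exponent
      \<open>L / 200\<close> can only increase the power.\<close>
    also have "\<dots> \<le> (8 * r) powr (L / 200)"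
      using r0 d(2) prof(1) by (intro powr_mono') auto
    finally have "8 * (8 * r) ^ n \<le> \<tau>\<^sup>2" using d(3) by simp
    then have "2 / 3 \<le> (real m + 1) * (4 * exp (- (r\<^sup>2 * d / 4)) / \<tau>\<^sup>2)"
      \<comment> \<open>Here \<epsilon> < \<alpha> / 3 enters: it gives \<alpha> - 2 * \<epsilon> >
        \<alpha> / 3 > \<tau>.\<close>
      using learns \<epsilon> d(4) r0 d(2)
      by (intro sq_query_lower_bound[OF d(1) prof(3,4,6,5,2) \<alpha>2 _ _ \<tau>0]) (auto simp: \<tau>_def L_def)
    with d(5) have "(2 powr (real d powr (1/4)) + 1) * (4 * exp (- (r\<^sup>2 * d / 4)) / \<tau>\<^sup>2) <
        (real m + 1) * (4 * exp (- (r\<^sup>2 * d / 4)) / \<tau>\<^sup>2)" by linarith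
    then have "2 powr (real d powr (1/4)) + 1 < real m + 1"
      by (rule mult_right_less_imp_less) simp
    then show "real m \<ge> 2 powr (real d powr (1/4))" by simp
  qed
qed

end
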